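(* Let $L$ be a locally compact Hausdorff topological space and $Y$ a complex Banach space, where $Y$ and $C_0(L)$ have dimension at least two. If $Y$ is $\mathbb C$-uniformly convex, then the subspace $\mathcal K(C_0(L),Y)$ has the BPBp-RSE, where $C_0(L)$ is the complex Banach space of complex-valued continuous functions on $L$ vanishing at infinity with the supremum norm.
   Context: All Banach spaces here are complex; $B_X$, $S_X$ are the closed unit ball and unit sphere of $X$; $\mathbb T=\{\lambda\in\mathbb C:|\lambda|=1\}$; $\mathcal L(X,Y)$ and $\mathcal K(X,Y)$ are the spaces of bounded and of compact linear operators. An operator $T\in\mathcal L(X,Y)$ is range strongly exposing, $T\in\mathrm{RSE}(X,Y)$, if there is $x_0\in S_X$ such that whenever $(x_n)\subseteq B_X$ satisfies $\|Tx_n\|\to\|T\|$, there are a subsequence $(x_{\sigma(n)})$ and $\lambda\in\mathbb T$ with $Tx_{\sigma(n)}\to\lambda Tx_0$. A linear subspace $\mathcal M\subseteq\mathcal L(X,Y)$ has the BPBp-RSE if for every $\varepsilon>0$ there is $0<\eta(\varepsilon)<\varepsilon$ such that for every $T\in\mathcal M$ with $\|T\|=1$ and every $x\in S_X$ with $\|Tx\|>1-\eta(\varepsilon)$, there exist $S\in\mathrm{RSE}(X,Y)\cap\mathcal M$ and $x_0\in S_X$ with $\|S\|=\|Sx_0\|=1$, $\|S-T\|<\varepsilon$ and $\|x-x_0\|<\varepsilon$. A complex Banach space $Y$ is $\mathbb C$-uniformly convex if for every $\varepsilon>0$ there is $\delta>0$ such that whenever $y_0,y_1\in Y$ satisfy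 $\|y_0+wy_1\|\le 1$ for every $w\in\mathbb T$ and $\|y_1\|>\varepsilon$, one has $\|y_0\|<1-\delta$. *)

theory Defs
  imports "HOL-Analysis.Analysis"
begin

section \<open>Complex Banach spaces\<close>

class complex_vector = real_vector +
  fixes scaleC :: "complex \<Rightarrow> 'a \<Rightarrow> 'a" (infixr \<open>*\<^sub>C\<close> 75)
  assumes scaleC_add_right: "a *\<^sub>C (x + y) = a *\<^sub>C x + a *\<^sub>C y"
    and scaleC_add_left: "(a + b) *\<^sub>C x = a *\<^sub>C x + b *\<^sub>C x"
    and scaleC_scaleC: "a *\<^sub>C (b *\<^sub>C x) = (a * b) *\<^sub>C x"
    and scaleC_one: "1 *\<^sub>C x = x"
    and scaleR_scaleC: "r *\<^sub>R x = complex_of_real r *\<^sub>C x"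

class complex_normed_vector = complex_vector + real_normed_vector +
  assumes norm_scaleC: "norm (a *\<^sub>C x) = cmod a * norm x"

class complex_banach = complex_normed_vector + complete_space

global_interpretation complex_vector:
  vector_space "scaleC :: complex \<Rightarrow> 'a \<Rightarrow> 'a::complex_vector"
  by unfold_locales (simp_all add: scaleC_add_right scaleC_add_left scaleC_scaleC scaleC_one)

text \<open>The library's \<open>dim\<close> is \<open>0\<close> on infinite-dimensional spaces, hence the
  following formulation through linearly independent sets.\<close>

definition complex_dim_at_least :: "nat \<Rightarrow> 'a::complex_vector itself \<Rightarrow> bool" where
  "complex_dim_at_least n _ \<longleftrightarrow>
    (\<exists>B :: 'a set. finite B \<and> card B = n \<and> complex_vector.independent B)"

section \<open>The space of continuous functions vanishing at infinity\<close>

typedef (overloaded) 'l C0 =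
  "{f :: 'l::topological_space \<Rightarrow> complex.
      continuous_on UNIV f \<and> (\<forall>e>0. compact {x. e \<le> cmod (f x)})}"
  morphisms apply_C0 Abs_C0
proof (rule exI[of _ "\<lambda>_. 0"])
  show "(\<lambda>_::'l. 0) \<in> {f :: 'l \<Rightarrow> complex.
      continuous_on UNIV f \<and> (\<forall>e>0. compact {x. e \<le> cmod (f x)})}"
    by (auto simp: not_le)
qed

setup_lifting type_definition_C0

lemma C0_eqI: "(\<And>x. apply_C0 f x = apply_C0 g x) \<Longrightarrow> f = g"
  by transfer auto

lemma continuous_on_apply_C0: "continuous_on UNIV (apply_C0 f)"
  using apply_C0[of f] by simp

lemma compact_apply_C0: "e > 0 \<Longrightarrow> compact {x. e \<le> cmod (apply_C0 f x)}"
  using apply_C0[of f] by simp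

lemma compact_level_subset:
  fixes h :: "'l::topological_space \<Rightarrow> complex"
  assumes "continuous_on UNIV h" "compact K" "{x. e \<le> cmod (h x)} \<subseteq> K"
  shows "compact {x. e \<le> cmod (h x)}"
proof -
  have "closed {x. e \<le> cmod (h x)}"
    by (intro closed_Collect_le continuous_intros assms)
  then have "compact (K \<inter> {x. e \<le> cmod (h x)})"
    using assms(2) by (rule compact_Int_closed[rotated])
  moreover have "K \<inter> {x. e \<le> cmod (h x)} = {x. e \<le> cmod (h x)}"
    using assms(3) by blast
  ultimately show ?thesis by simp
qed

lemma compact_level_add:
  fixes f g h :: "'l::topological_space \<Rightarrow> complex"
  assumes "continuous_on UNIV h"
    and "\<forall>e>0. compact {x. e \<le> cmod (f x)}" "\<forall>e>0. compact {x. e \<le> cmod (g x)}"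
    and le: "\<And>x. cmod (h x) \<le> cmod (f x) + cmod (g x)" and "e > 0"
  shows "compact {x. e \<le> cmod (h x)}"
proof (rule compact_level_subset)
  show "compact ({x. e/2 \<le> cmod (f x)} \<union> {x. e/2 \<le> cmod (g x)})"
    using assms(2,3) \<open>e > 0\<close>[THEN half_gt_zero] by (intro compact_Un) blast+
  have "e/2 \<le> cmod (f x) \<or> e/2 \<le> cmod (g x)" if "e \<le> cmod (h x)" for x
    using that le[of x] by linarith
  then show "{x. e \<le> cmod (h x)} \<subseteq> {x. e/2 \<le> cmod (f x)} \<union> {x. e/2 \<le> cmod (g x)}"
    by blast
qed fact

lemma compact_level_plus:
  fixes f g :: "'l::topological_space \<Rightarrow> complex"
  assumes "continuous_on UNIV f" "\<forall>e>0. compact {x. e \<le> cmod (f x)}"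
    and "continuous_on UNIV g" "\<forall>e>0. compact {x. e \<le> cmod (g x)}" and "e > 0"
  shows "compact {x. e \<le> cmod (f x + g x)}"
  using continuous_on_add[OF assms(1,3)] assms(2,4) norm_triangle_ineq assms(5)
  by (rule compact_level_add)

lemma compact_level_minus:
  fixes f g :: "'l::topological_space \<Rightarrow> complex"
  assumes "continuous_on UNIV f" "\<forall>e>0. compact {x. e \<le> cmod (f x)}"
    and "continuous_on UNIV g" "\<forall>e>0. compact {x. e \<le> cmod (g x)}" and "e > 0"
  shows "compact {x. e \<le> cmod (f x - g x)}"
  using continuous_on_diff[OF assms(1,3)] assms(2,4) norm_triangle_ineq4 assms(5)
  by (rule compact_level_add)

lemma compact_level_scale:
  fixes f :: "'l::topological_space \<Rightarrow> complex"
  assumes "\<forall>e>0. compact {x. e \<le> cmod (f x)}" and "e > 0"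
  shows "compact {x. e \<le> cmod (c * f x)}"
proof (cases "c = 0")
  case True
  then have "{x. e \<le> cmod (c * f x)} = {}" using assms(2) by (auto simp: not_le)
  then show ?thesis by (metis compact_empty)
next
  case False
  then have "{x. e \<le> cmod (c * f x)} = {x. e / cmod c \<le> cmod (f x)}"
    by (auto simp: norm_mult field_simps)
  then show ?thesis using assms False by simp
qed

lemma bounded_apply_C0: "bounded (range (apply_C0 f))"
proof -
  have "compact {x. 1 \<le> cmod (apply_C0 f x)}"
    by (rule compact_apply_C0) simp
  then have "compact (apply_C0 f ` {x. 1 \<le> cmod (apply_C0 f x)})"
    by (intro compact_continuous_image continuous_on_subset[OF continuous_on_apply_C0]) auto
  then obtain B where "\<forall>z \<in> apply_C0 f ` {x. 1 \<le> cmod (apply_C0 f x)}. cmod z \<le> B"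
    by (auto dest!: compact_imp_bounded simp only: bounded_iff)
  then have B: "1 \<le> cmod (apply_C0 f x) \<Longrightarrow> cmod (apply_C0 f x) \<le> B" for x
    by blast
  have "cmod (apply_C0 f x) \<le> max 1 B" for x
    using B[of x] by linarith
  then show ?thesis
    by (intro boundedI[of _ "max 1 B"]) blast
qed

instantiation C0 :: (topological_space) complex_vector
begin

lift_definition zero_C0 :: "'a C0" is "\<lambda>_. 0"
  by (auto simp: not_le)

lift_definition plus_C0 :: "'a C0 \<Rightarrow> 'a C0 \<Rightarrow> 'a C0" is "\<lambda>f g x. f x + g x"
  by (simp add: continuous_on_add) (blast intro: compact_level_plus)

lift_definition minus_C0 :: "'a C0 \<Rightarrow> 'a C0 \<Rightarrow> 'a C0" is "\<lambda>f g x. f x - g x"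
  by (simp add: continuous_on_diff) (blast intro: compact_level_minus)

lift_definition uminus_C0 :: "'a C0 \<Rightarrow> 'a C0" is "\<lambda>f x. - f x"
  by (auto intro!: continuous_intros)

lift_definition scaleC_C0 :: "complex \<Rightarrow> 'a C0 \<Rightarrow> 'a C0" is "\<lambda>c f x. c * f x"
  by (simp add: compact_level_scale continuous_on_mult_left)

definition scaleR_C0 :: "real \<Rightarrow> 'a C0 \<Rightarrow> 'a C0" where
  "scaleR_C0 r f = complex_of_real r *\<^sub>C f"

instance
proof
  fix a b :: real and c d :: complex and f g h :: "'a C0"
  show "f + g + h = f + (g + h)" "f + g = g + f" "0 + f = f" "- f + f = 0" "f - g = f + - g"
    by (transfer; auto)+
  show "a *\<^sub>R (f + g) = a *\<^sub>R f + a *\<^sub>R g" "(a + b) *\<^sub>R f = a *\<^sub>R f + b *\<^sub>R f"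
    "a *\<^sub>R b *\<^sub>R f = (a * b) *\<^sub>R f" "1 *\<^sub>R f = f"
    unfolding scaleR_C0_def by (transfer; auto simp: algebra_simps)+
  show "c *\<^sub>C (f + g) = c *\<^sub>C f + c *\<^sub>C g" "(c + d) *\<^sub>C f = c *\<^sub>C f + d *\<^sub>C f"
    "c *\<^sub>C d *\<^sub>C f = (c * d) *\<^sub>C f" "1 *\<^sub>C f = f"
    by (transfer; auto simp: algebra_simps)+
qed (rule scaleR_C0_def)

end

instantiation C0 :: (topological_space) complex_normed_vector
begin

definition norm_C0 :: "'a C0 \<Rightarrow> real" where
  "norm_C0 f = (SUP x. cmod (apply_C0 f x))"

definition dist_C0 :: "'a C0 \<Rightarrow> 'a C0 \<Rightarrow> real" where
  "dist_C0 f g = norm (f - g)"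

definition sgn_C0 :: "'a C0 \<Rightarrow> 'a C0" where
  "sgn_C0 f = f /\<^sub>R norm f"

definition uniformity_C0 :: "('a C0 \<times> 'a C0) filter" where
  "uniformity_C0 = (INF e\<in>{0<..}. principal {(f, g). dist f g < e})"

definition open_C0 :: "'a C0 set \<Rightarrow> bool" where
  "open_C0 S \<longleftrightarrow> (\<forall>f\<in>S. \<forall>\<^sub>F (f', g) in uniformity. f' = f \<longrightarrow> g \<in> S)"

lemma norm_apply_C0_le: "cmod (apply_C0 f x) \<le> norm f" for f :: "'a C0"
proof -
  obtain B where "\<And>y. cmod (apply_C0 f y) \<le> B"
    using bounded_apply_C0[of f] by (auto simp: bounded_iff)
  then show ?thesis
    unfolding norm_C0_def by (intro cSUP_upper bdd_aboveI2[of _ _ B]) auto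
qed

lemma norm_C0_le: "(\<And>x. cmod (apply_C0 f x) \<le> B) \<Longrightarrow> norm f \<le> B" for f :: "'a C0"
  unfolding norm_C0_def by (intro cSUP_least) auto

lemma norm_scaleC_C0: "norm (c *\<^sub>C f) = cmod c * norm f" for f :: "'a C0"
proof (rule antisym)
  show le: "norm (c *\<^sub>C f) \<le> cmod c * norm f" for c and f :: "'a C0"
    by (rule norm_C0_le)
      (simp add: scaleC_C0.rep_eq norm_mult mult_left_mono norm_apply_C0_le)
  show "cmod c * norm f \<le> norm (c *\<^sub>C f)"
  proof (cases "c = 0")
    case True
    have "0 \<le> cmod (apply_C0 (c *\<^sub>C f) undefined)" by simp
    also have "\<dots> \<le> norm (c *\<^sub>C f)" by (rule norm_apply_C0_le)
    finally show ?thesis using True by simp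
  next
    case False
    have "f = inverse c *\<^sub>C (c *\<^sub>C f)"
      using False by (simp add: scaleC_scaleC scaleC_one)
    then have "norm f \<le> cmod (inverse c) * norm (c *\<^sub>C f)"
      using le[of "inverse c" "c *\<^sub>C f"] by metis
    then have "cmod c * norm f \<le> cmod c * (cmod (inverse c) * norm (c *\<^sub>C f))"
      by (rule mult_left_mono) simp
    also have "\<dots> = norm (c *\<^sub>C f)"
      using False by (simp add: norm_inverse)
    finally show ?thesis .
  qed
qed

instance
proof
  fix a :: real and c :: complex and f g :: "'a C0"
  show "dist f g = norm (f - g)" by (rule dist_C0_def)
  show "sgn f = f /\<^sub>R norm f" by (rule sgn_C0_def)
  show "uniformity = (INF e\<in>{0<..}. principal {(f, g::'a C0). dist f g < e})"
    by (rule uniformity_C0_def)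
  show "open S \<longleftrightarrow> (\<forall>f\<in>S. \<forall>\<^sub>F (f', g) in uniformity. f' = f \<longrightarrow> g \<in> S)" for S :: "'a C0 set"
    by (rule open_C0_def)
  show "norm f = 0 \<longleftrightarrow> f = 0"
  proof
    assume *: "norm f = 0"
    have "apply_C0 f x = 0" for x
      using norm_apply_C0_le[of f x] * by simp
    then show "f = 0" by (intro C0_eqI) (simp add: zero_C0.rep_eq)
  qed (simp add: norm_C0_def zero_C0.rep_eq)
  show "norm (f + g) \<le> norm f + norm g"
    by (rule norm_C0_le)
      (auto simp: plus_C0.rep_eq intro!: norm_triangle_le add_mono norm_apply_C0_le)
  show "norm (c *\<^sub>C f) = cmod c * norm f" by (rule norm_scaleC_C0)
  show "norm (a *\<^sub>R f) = \<bar>a\<bar> * norm f"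
    by (simp add: scaleR_C0_def norm_scaleC_C0)
qed

end

instance C0 :: (topological_space) complex_banach
proof
  fix f :: "nat \<Rightarrow> 'a C0"
  assume "Cauchy f"
  have app: "dist (apply_C0 u x) (apply_C0 v x) \<le> dist u v" for u v :: "'a C0" and x
    using norm_apply_C0_le[of "u - v" x] by (simp add: dist_norm minus_C0.rep_eq)
  have "\<exists>l. \<forall>e>0. \<exists>N. \<forall>n x. N \<le> n \<and> True \<longrightarrow> dist (apply_C0 (f n) x) (l x) < e"
    unfolding uniformly_convergent_eq_cauchy
    using \<open>Cauchy f\<close> app unfolding Cauchy_def by (meson le_less_trans)
  then obtain l where l: "\<And>e. e > 0 \<Longrightarrow> \<exists>N. \<forall>n\<ge>N. \<forall>x. dist (apply_C0 (f n) x) (l x) < e"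
    by metis
  have "uniform_limit UNIV (\<lambda>n. apply_C0 (f n)) l sequentially"
    unfolding uniform_limit_sequentially_iff using l by blast
  then have cont: "continuous_on UNIV l"
    by (rule uniform_limit_theorem[rotated]) (auto intro: always_eventually continuous_on_apply_C0)
  have "compact {x. e \<le> cmod (l x)}" if e: "e > 0" for e
  proof -
    obtain n where n: "\<And>x. dist (apply_C0 (f n) x) (l x) < e/2"
      using l[OF half_gt_zero[OF e]] by blast
    show ?thesis
    proof (rule compact_level_subset[OF cont compact_apply_C0])
      have "e/2 \<le> cmod (apply_C0 (f n) x)" if "e \<le> cmod (l x)" for x
        using that n[of x] norm_triangle_ineq2[of "l x" "apply_C0 (f n) x"]
        by (simp add: dist_norm norm_minus_commute)
      then show "{x. e \<le> cmod (l x)} \<subseteq> {x. e/2 \<le> cmod (apply_C0 (f n) x)}" by blast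
    qed (use e in simp)
  qed
  then have g: "apply_C0 (Abs_C0 l) = l"
    using cont by (intro Abs_C0_inverse) simp
  have "f \<longlonglongrightarrow> Abs_C0 l"
  proof (rule metric_LIMSEQ_I)
    fix e :: real assume "e > 0"
    then obtain N where N: "\<forall>n\<ge>N. \<forall>x. dist (apply_C0 (f n) x) (l x) < e/2"
      using l[OF half_gt_zero] by blast
    have "dist (f n) (Abs_C0 l) < e" if "n \<ge> N" for n
    proof -
      have "cmod (apply_C0 (f n - Abs_C0 l) x) \<le> e/2" for x
        using N[rule_format, OF that, of x] by (simp add: minus_C0.rep_eq g dist_norm)
      then have "dist (f n) (Abs_C0 l) \<le> e/2"
        unfolding dist_norm by (rule norm_C0_le)
      then show ?thesis using \<open>e > 0\<close> by simp
    qed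
    then show "\<exists>N. \<forall>n\<ge>N. dist (f n) (Abs_C0 l) < e" by blast
  qed
  then show "convergent f" by (rule convergentI)
qed

section \<open>Operators\<close>

text \<open>Elements of \<open>'a \<Rightarrow>\<^sub>L 'b\<close> are the real-linear bounded operators, with the operator norm.\<close>

definition complex_operators ::
    "('a::complex_normed_vector \<Rightarrow>\<^sub>L 'b::complex_normed_vector) set" where
  "complex_operators = {T. \<forall>c x. blinfun_apply T (c *\<^sub>C x) = c *\<^sub>C blinfun_apply T x}"

definition compact_operators ::
    "('a::complex_normed_vector \<Rightarrow>\<^sub>L 'b::complex_normed_vector) set" where
  "compact_operators =
    {T \<in> complex_operators. compact (closure (blinfun_apply T ` cball 0 1))}"

definition range_strongly_exposing ::
    "('a::complex_normed_vector \<Rightarrow>\<^sub>L 'b::complex_normed_vector) set" where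
  "range_strongly_exposing =
    {T \<in> complex_operators. \<exists>x0. norm x0 = 1 \<and>
      (\<forall>x :: nat \<Rightarrow> 'a.
        (\<forall>n. norm (x n) \<le> 1) \<and> (\<lambda>n. norm (blinfun_apply T (x n))) \<longlonglongrightarrow> norm T \<longrightarrow>
        (\<exists>\<sigma> c. strict_mono \<sigma> \<and> cmod c = 1 \<and>
          (\<lambda>n. blinfun_apply T (x (\<sigma> n))) \<longlonglongrightarrow> c *\<^sub>C blinfun_apply T x0))}"

definition BPBp_RSE ::
    "('a::complex_normed_vector \<Rightarrow>\<^sub>L 'b::complex_normed_vector) set \<Rightarrow> bool" where
  "BPBp_RSE M \<longleftrightarrow>
    (\<forall>\<epsilon>>0. \<exists>\<eta>. 0 < \<eta> \<and> \<eta> < \<epsilon> \<and>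
      (\<forall>T\<in>M. \<forall>x. norm T = 1 \<and> norm x = 1 \<and> norm (blinfun_apply T x) > 1 - \<eta> \<longrightarrow>
        (\<exists>S \<in> range_strongly_exposing \<inter> M. \<exists>x0. norm x0 = 1 \<and>
          norm S = 1 \<and> norm (blinfun_apply S x0) = 1 \<and>
          norm (S - T) < \<epsilon> \<and> norm (x - x0) < \<epsilon>)))"

definition complex_uniformly_convex :: "'b::complex_normed_vector itself \<Rightarrow> bool" where
  "complex_uniformly_convex _ \<longleftrightarrow>
    (\<forall>\<epsilon>>0. \<exists>\<delta>>0. \<forall>y0 y1 :: 'b.
      (\<forall>w. cmod w = 1 \<longrightarrow> norm (y0 + w *\<^sub>C y1) \<le> 1) \<and> norm y1 > \<epsilon> \<longrightarrow> norm y0 < 1 - \<delta>)"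

end

theory Submission
  imports Defs
begin

text \<open>
  The guiding principle is that an operator \<open>R\<close> of norm at most one from \<open>C0\<close> to a uniformly convex
  space \<open>Y\<close> (in the complex sense) can hardly see what happens away from a peak.  If \<open>R p\<close> has
  almost norm one and \<open>h\<close> is a function in the unit ball that lives where \<open>|p| \<le> 1 - \<beta>\<close>, then
  \<open>p + w \<beta> h\<close> stays in the unit ball for all unimodular \<open>w\<close>, so \<open>R h\<close> is small
  (\<open>small_off_peak\<close>).  Applied to the midpoint of
  two functions this shows that, if \<open>R\<close> almost attains its norm at the midpoint of \<open>p\<close> and \<open>q\<close>,
  then \<open>R\<close> cannot tell \<open>p\<close> from \<open>q\<close>, even after multiplication by bounded functions
  (\<open>small_on_difference\<close>).

  Now let \<open>T\<close> be compact of norm one and almost attain its norm at \<open>f\<close>.  Multiplying the argument by a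
  cutoff of \<open>|f|\<close> changes \<open>T\<close> little and makes it depend only on values at points where a function
  \<open>f0\<close> close to \<open>f\<close> is unimodular (\<open>localise_at_peak\<close>).  Next, with \<open>\<psi>\<close> norming the direction \<open>y\<close> of
  the value at \<open>f0\<close>, composition with \<open>z \<mapsto> z + \<alpha> \<psi>(z) y\<close> forces \<open>\<psi>\<close> to be nearly maximal along
  any maximising sequence \<open>g n\<close>; after rotations, the operator therefore cannot tell \<open>g n\<close> from
  \<open>f0\<close>.  Hence replacing the argument \<open>h\<close> by \<open>h (cnj f0) (g n)\<close> is a small change, and it carries
  \<open>f0\<close> to \<open>|f0|\<^sup>2 (g n)\<close>, which the operator identifies with \<open>g n\<close>.  Compactness and Tychonoff's
  theorem (\<open>compact_operator_cluster_point\<close>) give a pointwise limit of these operators, and it attains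
  its norm at \<open>f0\<close> (\<open>attain_at_peak\<close>).  The limit plays the part of a
  norm-attaining element of the bidual.

  One more stretching makes the result range strongly exposing: along any maximising sequence \<open>x n\<close>
  suitable rotations of \<open>x n\<close> become indistinguishable from \<open>f0\<close>, so the values converge to a
  unimodular multiple of the value at \<open>f0\<close> along a subsequence on which the rotations converge
  (\<open>stretch_range_strongly_exposing\<close>).
\<close>

section \<open>Norming functionals\<close>

definition sublinear :: "('a::real_vector \<Rightarrow> real) \<Rightarrow> bool" where
  "sublinear p \<longleftrightarrow>
    (\<forall>x y. p (x + y) \<le> p x + p y) \<and> (\<forall>c>0. \<forall>x. p (c *\<^sub>R x) \<le> c * p x)"

lemma sublinear_add: "sublinear p \<Longrightarrow> p (x + y) \<le> p x + p y"
  by (simp add: sublinear_def)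

lemma sublinear_scaleR:
  assumes "sublinear p" "c > 0"
  shows "p (c *\<^sub>R x) = c * p x"
proof (rule antisym)
  show "p (c *\<^sub>R x) \<le> c * p x" using assms by (simp add: sublinear_def)
  have "p (inverse c *\<^sub>R (c *\<^sub>R x)) \<le> inverse c * p (c *\<^sub>R x)"
    using assms unfolding sublinear_def by (meson positive_imp_inverse_positive)
  then show "c * p x \<le> p (c *\<^sub>R x)" using assms(2) by (simp add: field_simps)
qed

lemma sublinear_zero:
  assumes "sublinear p"
  shows "p 0 = 0"
  using sublinear_scaleR[OF assms, of 2 0] by simp

lemma sublinear_ge_minus:
  assumes "sublinear p"
  shows "- p (- x) \<le> p x"
  using sublinear_add[OF assms, of x "- x"] sublinear_zero[OF assms] by simp

text \<open>The largest sublinear functional below \<open>p\<close> whose value at \<open>- a\<close> is at most \<open>- p a\<close>.\<close>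

definition straighten :: "('a::real_vector \<Rightarrow> real) \<Rightarrow> 'a \<Rightarrow> 'a \<Rightarrow> real" where
  "straighten p a x = (INF t\<in>{0..}. p (x + t *\<^sub>R a) - t * p a)"

lemma straighten_le:
  assumes p: "sublinear p" and t: "0 \<le> t"
  shows "straighten p a x \<le> p (x + t *\<^sub>R a) - t * p a"
  unfolding straighten_def
proof (rule cINF_lower)
  show "bdd_below ((\<lambda>t. p (x + t *\<^sub>R a) - t * p a) ` {0..})"
  proof (rule bdd_belowI2[of _ "- p (- x)"])
    fix t :: real assume "t \<in> {0..}"
    then have "t * p a = p (t *\<^sub>R a)"
      using sublinear_scaleR[OF p, of t a] sublinear_zero[OF p] by (cases "t = 0") auto
    also have "\<dots> \<le> p (x + t *\<^sub>R a) + p (- x)"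
      using sublinear_add[OF p, of "x + t *\<^sub>R a" "- x"] by simp
    finally show "- p (- x) \<le> p (x + t *\<^sub>R a) - t * p a" by simp
  qed
qed (use t in simp)

lemma le_straighten:
  assumes "\<And>t. 0 \<le> t \<Longrightarrow> b \<le> p (x + t *\<^sub>R a) - t * p a"
  shows "b \<le> straighten p a x"
  unfolding straighten_def by (rule cINF_greatest) (use assms in auto)

lemma sublinear_straighten:
  assumes p: "sublinear p"
  shows "sublinear (straighten p a)"
  unfolding sublinear_def
proof (intro conjI allI impI)
  fix x y
  have *: "straighten p a (x + y) - (p (y + s *\<^sub>R a) - s * p a) \<le> p (x + t *\<^sub>R a) - t * p a"
    if "0 \<le> s" "0 \<le> t" for s t
    using straighten_le[OF p, of "s + t" a "x + y"] that
      sublinear_add[OF p, of "x + t *\<^sub>R a" "y + s *\<^sub>R a"]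
    by (simp add: algebra_simps)
  have "straighten p a (x + y) - straighten p a x \<le> p (y + s *\<^sub>R a) - s * p a"
    if "0 \<le> s" for s
  proof -
    have "straighten p a (x + y) - (p (y + s *\<^sub>R a) - s * p a) \<le> straighten p a x"
      by (rule le_straighten) (rule *[OF that])
    then show ?thesis by simp
  qed
  then show "straighten p a (x + y) \<le> straighten p a x + straighten p a y"
    using le_straighten[of "straighten p a (x + y) - straighten p a x" p y a]
    by (simp add: algebra_simps)
next
  fix c :: real and x assume c: "c > 0"
  have "straighten p a (c *\<^sub>R x) / c \<le> p (x + t *\<^sub>R a) - t * p a" if "0 \<le> t" for t
  proof -
    have "straighten p a (c *\<^sub>R x) \<le> c * p (x + t *\<^sub>R a) - c * t * p a"
      using straighten_le[OF p, of "c * t" a "c *\<^sub>R x"] c that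
        sublinear_scaleR[OF p c, of "x + t *\<^sub>R a"] by (simp add: scaleR_add_right)
    then show ?thesis
      using c by (simp add: field_simps)
  qed
  then have "straighten p a (c *\<^sub>R x) / c \<le> straighten p a x"
    by (rule le_straighten)
  then show "straighten p a (c *\<^sub>R x) \<le> c * straighten p a x"
    using c by (simp add: field_simps)
qed

text \<open>Zorn's lemma gives a minimal sublinear functional below \<open>p\<close>; straightening it in any
  direction cannot lower it, so it is odd, and an odd sublinear functional is linear.\<close>

theorem sublinear_dominates_linear:
  assumes p: "sublinear p"
  obtains f where "linear f" "\<And>x. f x \<le> p x"
proof -
  define A where "A = {q. sublinear q \<and> q \<le> p}"
  have "\<exists>m\<in>A. \<forall>q\<in>A. q \<le> m \<longrightarrow> q = m"
  proof (rule predicate_Zorn)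
    show "partial_order_on A (relation_of (\<lambda>q q'. q' \<le> q) A)"
      by (rule partial_order_on_relation_ofI) auto
  next
    fix C assume C: "C \<in> Chains (relation_of (\<lambda>q q'. q' \<le> q) A)"
    have CA: "q \<in> A" if "q \<in> C" for q
      using Chains_relation_of[OF C] that by blast
    have total: "q \<le> q' \<or> q' \<le> q" if "q \<in> C" "q' \<in> C" for q q'
      using C that unfolding Chains_def relation_of_def by auto
    show "\<exists>u\<in>A. \<forall>q\<in>C. u \<le> q"
    proof (cases "C = {}")
      case True
      then show ?thesis using p by (auto simp: A_def)
    next
      case False
      define u where "u = (\<lambda>x. INF q\<in>C. q x)"
      have bdd: "bdd_below ((\<lambda>q. q x) ` C)" for x
      proof (rule bdd_belowI2[of _ "- p (- x)"])
        fix q assume "q \<in> C"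
        then have "sublinear q" "q (- x) \<le> p (- x)"
          using CA[of q] by (auto simp: A_def le_fun_def)
        then show "- p (- x) \<le> q x" using sublinear_ge_minus[of q x] by simp
      qed
      have u_le: "u x \<le> q x" if "q \<in> C" for q x
        unfolding u_def by (rule cINF_lower[OF bdd that])
      have le_u: "b \<le> u x" if "\<And>q. q \<in> C \<Longrightarrow> b \<le> q x" for b x
        unfolding u_def by (rule cINF_greatest[OF False]) (rule that)
      have "sublinear u"
        unfolding sublinear_def
      proof (intro conjI allI impI)
        fix x y
        have *: "u (x + y) \<le> q x + q' y" if "q \<in> C" "q' \<in> C" for q q'
        proof -
          have "\<exists>r\<in>C. r \<le> q \<and> r \<le> q'"
            using total[OF that] that by blast
          then obtain r where r: "r \<in> C" "r \<le> q" "r \<le> q'" by blast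
          have "u (x + y) \<le> r x + r y"
            using u_le[OF r(1), of "x + y"] sublinear_add[of r x y] CA[OF r(1)]
            by (simp add: A_def)
          also have "\<dots> \<le> q x + q' y"
            using r by (intro add_mono) (auto simp: le_fun_def)
          finally show ?thesis .
        qed
        then have "u (x + y) - u x \<le> q' y" if "q' \<in> C" for q'
          using le_u[of "u (x + y) - q' y" x] that by (simp add: algebra_simps)
        then show "u (x + y) \<le> u x + u y"
          using le_u[of "u (x + y) - u x" y] by (simp add: algebra_simps)
      next
        fix c :: real and x assume c: "c > 0"
        have "u (c *\<^sub>R x) / c \<le> q x" if "q \<in> C" for q
          using u_le[OF that, of "c *\<^sub>R x"] CA[OF that] c
          by (simp add: A_def sublinear_scaleR field_simps)
        then have "u (c *\<^sub>R x) / c \<le> u x" by (rule le_u)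
        then show "u (c *\<^sub>R x) \<le> c * u x" using c by (simp add: field_simps)
      qed
      moreover have "u \<le> p"
      proof -
        obtain q where "q \<in> C" using False by blast
        then have "u \<le> q" "q \<le> p" using u_le CA[of q] by (auto simp: A_def le_fun_def)
        then show ?thesis by (rule order_trans)
      qed
      ultimately show ?thesis
        using u_le by (auto simp: A_def le_fun_def)
    qed
  qed
  then obtain m where m: "sublinear m" "m \<le> p"
    and min: "\<And>q. sublinear q \<Longrightarrow> q \<le> m \<Longrightarrow> q = m"
    unfolding A_def using order_trans by blast
  have odd: "m (- x) = - m x" for x
  proof -
    have "straighten m x = m"
      using straighten_le[OF m(1), of 0]
      by (intro min sublinear_straighten m(1)) (simp add: le_fun_def)
    then have "m (- x) \<le> - m x"
      using straighten_le[OF m(1), of 1 x "- x"] sublinear_zero[OF m(1)] by simp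
    then show ?thesis using sublinear_ge_minus[OF m(1), of x] by simp
  qed
  have add: "m (x + y) = m x + m y" for x y
    using sublinear_add[OF m(1), of x y] sublinear_add[OF m(1), of "- x" "- y"]
      odd[of "x + y"] odd[of x] odd[of y] by simp
  have "m (c *\<^sub>R x) = c *\<^sub>R m x" for c x
  proof (cases c "0 :: real" rule: linorder_cases)
    case less
    then have "m ((- c) *\<^sub>R x) = - c * m x" by (intro sublinear_scaleR m(1)) simp
    then show ?thesis using odd[of "c *\<^sub>R x"] by simp
  qed (simp_all add: sublinear_scaleR sublinear_zero m(1))
  then have "linear m" by (intro linearI add)
  then show ?thesis using that m(2) by (auto simp: le_fun_def)
qed

definition norming_functional :: "('a::complex_normed_vector \<Rightarrow> complex) \<Rightarrow> 'a \<Rightarrow> bool" where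
  "norming_functional \<psi> y \<longleftrightarrow>
    (\<forall>u v. \<psi> (u + v) = \<psi> u + \<psi> v) \<and> (\<forall>c u. \<psi> (c *\<^sub>C u) = c * \<psi> u) \<and>
    (\<forall>u. cmod (\<psi> u) \<le> norm u) \<and> \<psi> y = complex_of_real (norm y)"

lemma exists_rotation: "\<exists>c. cmod c = 1 \<and> c * z = complex_of_real (cmod z)"
proof (cases "z = 0")
  case False
  then have "cnj (sgn z) * z = complex_of_real (cmod z)"
    by (simp add: sgn_eq mult.commute[of _ z] complex_norm_square[symmetric] power2_eq_square)
  moreover have "cmod (cnj (sgn z)) = 1" using False by (simp add: norm_sgn)
  ultimately show ?thesis by blast
qed (auto intro: exI[of _ 1])

text \<open>The Hahn--Banach theorem in the form needed here: the real part comes from a linear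
  functional below the norm straightened along \<open>y\<close>, which is forced to take the value
  \<open>norm y\<close> at \<open>y\<close>.\<close>

theorem norming_functional_exists:
  fixes y :: "'a::complex_normed_vector"
  shows "\<exists>\<psi>. norming_functional \<psi> y"
proof -
  have sub: "sublinear (norm :: 'a \<Rightarrow> real)"
    by (auto simp: sublinear_def norm_triangle_ineq)
  obtain f where f: "linear f" "\<And>x. f x \<le> straighten norm y x"
    using sublinear_dominates_linear[OF sublinear_straighten[OF sub]] by blast
  have fle: "f x \<le> norm x" for x
    using f(2)[of x] straighten_le[OF sub, of 0 y x] by simp
  have "f (- y) \<le> - norm y"
    using f(2)[of "- y"] straighten_le[OF sub, of 1 y "- y"] by simp
  then have fy: "f y = norm y"
    using fle[of y] by (simp add: linear_neg[OF f(1)])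
  define \<psi> where "\<psi> u = Complex (f u) (- f (\<i> *\<^sub>C u))" for u
  have add: "\<psi> (u + v) = \<psi> u + \<psi> v" for u v
    by (simp add: \<psi>_def complex_eq_iff scaleC_add_right linear_add[OF f(1)])
  have scaleC: "\<psi> (c *\<^sub>C u) = c * \<psi> u" for c u
  proof -
    have c: "c *\<^sub>C v = Re c *\<^sub>R v + Im c *\<^sub>R (\<i> *\<^sub>C v)" for v :: 'a
    proof -
      have "c *\<^sub>C v = (complex_of_real (Re c) + complex_of_real (Im c) * \<i>) *\<^sub>C v"
        by (metis complex_eq mult.commute)
      then show ?thesis by (simp only: scaleC_add_left scaleR_scaleC scaleC_scaleC)
    qed
    have ii: "\<i> *\<^sub>C \<i> *\<^sub>C u = - u"
      using scaleR_scaleC[of "-1" u] by (simp add: scaleC_scaleC)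
    have swap: "\<i> *\<^sub>C c *\<^sub>C u = c *\<^sub>C \<i> *\<^sub>C u" by (simp add: scaleC_scaleC mult.commute)
    show ?thesis
      unfolding \<psi>_def swap
      by (simp only: c ii linear_add[OF f(1)] linear_scale[OF f(1)] linear_neg[OF f(1)])
        (simp add: complex_eq_iff linear_neg[OF f(1)])
  qed
  have le: "cmod (\<psi> u) \<le> norm u" for u
  proof -
    obtain c where c: "cmod c = 1" "c * \<psi> u = complex_of_real (cmod (\<psi> u))"
      using exists_rotation by blast
    have "cmod (\<psi> u) = Re (\<psi> (c *\<^sub>C u))" by (simp add: scaleC c)
    also have "\<dots> \<le> norm (c *\<^sub>C u)" using fle by (simp add: \<psi>_def)
    finally show ?thesis by (simp add: norm_scaleC c)
  qed
  have "(Re (\<psi> y))\<^sup>2 + (Im (\<psi> y))\<^sup>2 \<le> (norm y)\<^sup>2"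
    using power_mono[OF le[of y], of 2] by (simp add: cmod_power2)
  then have "\<psi> y = complex_of_real (norm y)"
    by (simp add: \<psi>_def fy complex_eq_iff)
  then show ?thesis
    unfolding norming_functional_def using add scaleC le by blast
qed

section \<open>Complex-linear and compact operators\<close>

lemma complex_operators_scaleC:
  "T \<in> complex_operators \<Longrightarrow> blinfun_apply T (c *\<^sub>C x) = c *\<^sub>C blinfun_apply T x"
  by (simp add: complex_operators_def)

lemma complex_operators_compose:
  "S \<in> complex_operators \<Longrightarrow> T \<in> complex_operators \<Longrightarrow> S o\<^sub>L T \<in> complex_operators"
  by (simp add: complex_operators_def)

lemma compact_operators_complex: "T \<in> compact_operators \<Longrightarrow> T \<in> complex_operators"
  by (simp add: compact_operators_def)

lemma compact_operatorsI:
  assumes "T \<in> complex_operators" "compact K" "blinfun_apply T ` cball 0 1 \<subseteq> K"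
  shows "T \<in> compact_operators"
proof -
  have "closure (blinfun_apply T ` cball 0 1) \<subseteq> K"
    using assms by (intro closure_minimal compact_imp_closed)
  then have "compact (closure (blinfun_apply T ` cball 0 1))"
    using compact_Int_closed[OF assms(2) closed_closure] by (metis inf.absorb_iff2)
  then show ?thesis using assms(1) by (simp add: compact_operators_def)
qed

lemma compact_operators_compose_left:
  assumes "S \<in> complex_operators" "T \<in> compact_operators"
  shows "S o\<^sub>L T \<in> compact_operators"
proof (rule compact_operatorsI)
  show "S o\<^sub>L T \<in> complex_operators"
    using assms by (auto intro: complex_operators_compose dest: compact_operators_complex)
  show "compact (blinfun_apply S ` closure (blinfun_apply T ` cball 0 1))"
    using assms by (intro compact_continuous_image) (auto simp: compact_operators_def intro!: continuous_intros)
  show "blinfun_apply (S o\<^sub>L T) ` cball 0 1 \<subseteq> blinfun_apply S ` closure (blinfun_apply T ` cball 0 1)"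
    by (auto intro!: imageI subsetD[OF closure_subset])
qed

lemma compact_operators_compose_right:
  assumes "S \<in> compact_operators" "T \<in> complex_operators" "norm T \<le> 1"
  shows "S o\<^sub>L T \<in> compact_operators"
proof (rule compact_operatorsI)
  show "S o\<^sub>L T \<in> complex_operators"
    using assms by (auto intro: complex_operators_compose dest: compact_operators_complex)
  show "compact (closure (blinfun_apply S ` cball 0 1))"
    using assms by (simp add: compact_operators_def)
  have "norm (blinfun_apply T x) \<le> 1" if "norm x \<le> 1" for x
    using norm_blinfun[of T x] mult_mono[OF assms(3) that] by simp
  then show "blinfun_apply (S o\<^sub>L T) ` cball 0 1 \<subseteq> closure (blinfun_apply S ` cball 0 1)"
    by (auto intro!: imageI subsetD[OF closure_subset])
qed

lemma complex_operators_scaleR: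
  "T \<in> complex_operators \<Longrightarrow> r *\<^sub>R T \<in> complex_operators"
  by (simp add: complex_operators_def scaleR_blinfun.rep_eq scaleR_scaleC scaleC_scaleC mult.commute)

lemma compact_operators_scaleR:
  assumes "T \<in> compact_operators"
  shows "r *\<^sub>R T \<in> compact_operators"
proof -
  have "r *\<^sub>R T = (r *\<^sub>R id_blinfun) o\<^sub>L T"
    by (rule blinfun_eqI) (simp add: scaleR_blinfun.rep_eq)
  moreover have "(r *\<^sub>R id_blinfun :: 'b \<Rightarrow>\<^sub>L 'b) \<in> complex_operators"
    by (intro complex_operators_scaleR) (simp add: complex_operators_def)
  ultimately show ?thesis using compact_operators_compose_left assms by metis
qed

lemma norm_blinfun_le_one:
  "norm T \<le> 1 \<Longrightarrow> norm x \<le> 1 \<Longrightarrow> norm (blinfun_apply T x) \<le> 1"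
  using norm_blinfun[of T x] mult_mono[of "norm T" 1 "norm x" 1] by simp

text \<open>Operators whose unit ball has its image in that of one compact operator form a relatively
  compact set in the topology of pointwise convergence, by Tychonoff's theorem.  Linearity
  and bounds survive in the limit because each involves only finitely many points.\<close>

theorem compact_operator_cluster_point:
  fixes S :: "'a::complex_normed_vector \<Rightarrow>\<^sub>L 'b::complex_normed_vector"
    and R :: "nat \<Rightarrow> 'a \<Rightarrow>\<^sub>L 'b"
  assumes S: "S \<in> compact_operators" and R: "\<And>n. R n \<in> complex_operators"
    and RS: "\<And>n. blinfun_apply (R n) ` cball 0 1 \<subseteq> blinfun_apply S ` cball 0 1"
  obtains R' where "R' \<in> compact_operators"
    "\<And>h e N. e > 0 \<Longrightarrow> \<exists>n\<ge>N. norm (blinfun_apply (R n) h - blinfun_apply R' h) < e"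
proof -
  define B where "B = closure (blinfun_apply S ` cball 0 1)"
  have B: "compact B" using S by (simp add: B_def compact_operators_def)
  have RB: "blinfun_apply (R n) h \<in> B" if "norm h \<le> 1" for n h
    using RS[of n] that closure_subset[of "blinfun_apply S ` cball 0 1"] unfolding B_def by force
  define K where "K h = (\<lambda>y. norm h *\<^sub>R y) ` B" for h :: 'a
  have K: "compact (K h)" for h
    unfolding K_def by (intro compact_continuous_image B continuous_intros)
  have RK: "blinfun_apply (R n) h \<in> K h" for n h
  proof (cases "h = 0")
    case True
    have "blinfun_apply (R n) 0 \<in> B" by (rule RB) simp
    then show ?thesis using True by (force simp: K_def)
  next
    case False
    have "blinfun_apply (R n) (h /\<^sub>R norm h) \<in> B" by (rule RB) (simp add: False)
    then show ?thesis
      using False unfolding K_def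
      by (intro image_eqI[of _ _ "blinfun_apply (R n) (h /\<^sub>R norm h)"])
        (simp_all add: blinfun.scaleR_right)
  qed
  have cP: "compact (Pi UNIV K)"
  proof -
    have "compactin (product_topology (\<lambda>_. euclidean) UNIV) (PiE UNIV K)"
      unfolding compactin_PiE using K by (simp add: compactin_euclidean_iff)
    then show ?thesis by (simp add: euclidean_product_topology compactin_euclidean_iff PiE_UNIV_domain)
  qed
  define D where "D N = closure ((\<lambda>n. blinfun_apply (R n)) ` {N..})" for N
  have "Pi UNIV K \<inter> (\<Inter>N\<in>UNIV. D N) \<noteq> {}"
  proof (rule compact_imp_fip_image[OF cP])
    fix I :: "nat set" assume "finite I"
    then obtain m where m: "\<And>i. i \<in> I \<Longrightarrow> i \<le> m"
      using finite_nat_set_iff_bounded_le by auto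
    have "blinfun_apply (R m) \<in> D i" if "i \<in> I" for i
      unfolding D_def using m[OF that] by (intro subsetD[OF closure_subset]) auto
    then have "blinfun_apply (R m) \<in> Pi UNIV K \<inter> (\<Inter>N\<in>I. D N)"
      using RK by auto
    then show "Pi UNIV K \<inter> (\<Inter>N\<in>I. D N) \<noteq> {}" by blast
  qed (simp add: D_def)
  then obtain F where F: "\<And>N. F \<in> D N" by blast
  have closed: "F \<in> C" if "closed C" "\<And>n. blinfun_apply (R n) \<in> C" for C
  proof -
    have "D 0 \<subseteq> C" unfolding D_def using that by (intro closure_minimal) auto
    then show ?thesis using F by blast
  qed
  have coord: "continuous_on UNIV (\<lambda>G::'a \<Rightarrow> 'b. G h)" for h by simp
  have scaleC_cont: "continuous_on UNIV (\<lambda>z::'b. c *\<^sub>C z)" for c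
  proof (rule linear_continuous_on)
    show "bounded_linear (\<lambda>z::'b. c *\<^sub>C z)"
      by (rule bounded_linear_intro[of _ "cmod c"])
        (simp_all add: scaleC_add_right scaleR_scaleC scaleC_scaleC norm_scaleC mult.commute)
  qed
  have add: "F (a + b) = F a + F b" for a b
  proof -
    have "F \<in> {G. G (a + b) = G a + G b}"
      by (rule closed) (auto intro!: closed_Collect_eq continuous_on_add coord simp: blinfun.add_right)
    then show ?thesis by simp
  qed
  have scaleC: "F (c *\<^sub>C a) = c *\<^sub>C F a" for c a
  proof -
    have "F \<in> {G. G (c *\<^sub>C a) = c *\<^sub>C G a}"
      by (rule closed)
        (auto intro!: closed_Collect_eq coord continuous_on_compose2[OF scaleC_cont]
          simp: complex_operators_scaleC[OF R])
    then show ?thesis by simp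
  qed
  have FB: "F h \<in> B" if "norm h \<le> 1" for h
  proof -
    have "F \<in> (\<lambda>G. G h) -` B"
      by (rule closed) (auto intro: closed_vimage compact_imp_closed B coord RB that)
    then show ?thesis by simp
  qed
  obtain M where M: "\<And>y. y \<in> B \<Longrightarrow> norm y \<le> M"
    using compact_imp_bounded[OF B] by (auto simp: bounded_iff)
  have scaleR: "F (r *\<^sub>R a) = r *\<^sub>R F a" for r a
    by (simp add: scaleR_scaleC scaleC)
  have "bounded_linear F"
  proof (rule bounded_linear_intro[of _ M])
    fix h
    show "norm (F h) \<le> norm h * M"
    proof (cases "h = 0")
      case True
      then show ?thesis using scaleR[of 0 0] by simp
    next
      case False
      have "norm (F (h /\<^sub>R norm h)) \<le> M" by (intro M FB) (simp add: False)
      then show ?thesis using False by (simp add: scaleR field_simps)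
    qed
  qed (simp_all add: add scaleR)
  then have F_eq: "blinfun_apply (Blinfun F) = F" by (rule bounded_linear_Blinfun_apply)
  show ?thesis
  proof
    show "Blinfun F \<in> compact_operators"
      using B FB by (intro compact_operatorsI[of _ B]) (auto simp: complex_operators_def F_eq scaleC)
    fix h e and N :: nat assume e: "(e::real) > 0"
    have "open ((\<lambda>G::'a \<Rightarrow> 'b. G h) -` ball (F h) e)"
      by (intro open_vimage coord) simp
    moreover have "F \<in> (\<lambda>G. G h) -` ball (F h) e" using e by simp
    ultimately obtain G where "G \<in> (\<lambda>n. blinfun_apply (R n)) ` {N..}" "G h \<in> ball (F h) e"
      using F[of N] unfolding D_def closure_iff_nhds_not_empty by blast
    then show "\<exists>n\<ge>N. norm (blinfun_apply (R n) h - blinfun_apply (Blinfun F) h) < e"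
      by (auto simp: F_eq dist_norm norm_minus_commute)
  qed
qed

section \<open>Multiplication operators and peaks on \<open>C0\<close>\<close>

lemma apply_C0_scaleR: "apply_C0 (r *\<^sub>R f) x = complex_of_real r * apply_C0 f x"
  by (simp add: scaleR_C0_def scaleC_C0.rep_eq)

text \<open>Meaningful for bounded continuous \<open>m\<close>, where the product again vanishes at infinity.\<close>

definition mult_C0 :: "('l::topological_space \<Rightarrow> complex) \<Rightarrow> 'l C0 \<Rightarrow>\<^sub>L 'l C0" where
  "mult_C0 m = Blinfun (\<lambda>f. Abs_C0 (\<lambda>x. m x * apply_C0 f x))"

lemma apply_mult_C0:
  assumes m: "continuous_on UNIV m" and B: "\<And>x. cmod (m x) \<le> B"
  shows "apply_C0 (blinfun_apply (mult_C0 m) f) x = m x * apply_C0 f x"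
proof -
  have B0: "0 \<le> B" using B[of undefined] norm_ge_zero order_trans by blast
  have app: "apply_C0 (Abs_C0 (\<lambda>x. m x * apply_C0 f x)) = (\<lambda>x. m x * apply_C0 f x)" for f
  proof (rule Abs_C0_inverse, simp, intro conjI allI impI)
    show cont: "continuous_on UNIV (\<lambda>x. m x * apply_C0 f x)"
      by (intro continuous_on_mult m continuous_on_apply_C0)
    fix e :: real assume e: "e > 0"
    show "compact {x. e \<le> cmod (m x * apply_C0 f x)}"
    proof (rule compact_level_subset[OF cont compact_apply_C0])
      show "e / (B + 1) > 0" using e B0 by simp
      have "e / (B + 1) \<le> cmod (apply_C0 f x)" if "e \<le> cmod (m x * apply_C0 f x)" for x
      proof -
        have "cmod (m x) * cmod (apply_C0 f x) \<le> (B + 1) * cmod (apply_C0 f x)"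
          using B[of x] by (intro mult_right_mono) auto
        then show ?thesis
          using that B0 by (simp add: norm_mult field_simps)
      qed
      then show "{x. e \<le> cmod (m x * apply_C0 f x)} \<subseteq> {x. e / (B + 1) \<le> cmod (apply_C0 f x)}"
        by blast
    qed
  qed
  have "bounded_linear (\<lambda>f. Abs_C0 (\<lambda>x. m x * apply_C0 f x))"
  proof (rule bounded_linear_intro[of _ B])
    fix f g :: "'a C0" and r :: real
    show "Abs_C0 (\<lambda>x. m x * apply_C0 (f + g) x) =
        Abs_C0 (\<lambda>x. m x * apply_C0 f x) + Abs_C0 (\<lambda>x. m x * apply_C0 g x)"
      by (rule C0_eqI, simp only: app) (simp add: app plus_C0.rep_eq distrib_left)
    show "Abs_C0 (\<lambda>x. m x * apply_C0 (r *\<^sub>R f) x) = r *\<^sub>R Abs_C0 (\<lambda>x. m x * apply_C0 f x)"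
      by (rule C0_eqI, simp only: app) (simp add: app apply_C0_scaleR)
    show "norm (Abs_C0 (\<lambda>x. m x * apply_C0 f x)) \<le> norm f * B"
    proof (rule norm_C0_le)
      fix x
      show "cmod (apply_C0 (Abs_C0 (\<lambda>x. m x * apply_C0 f x)) x) \<le> norm f * B"
        using mult_mono[OF norm_apply_C0_le[of f x] B[of x]]
        by (simp add: app norm_mult mult.commute)
    qed
  qed
  then show ?thesis
    by (simp add: mult_C0_def bounded_linear_Blinfun_apply app)
qed

lemma mult_C0_complex:
  assumes "continuous_on UNIV m" "\<And>x. cmod (m x) \<le> B"
  shows "mult_C0 m \<in> complex_operators"
  by (auto simp: complex_operators_def apply_mult_C0[OF assms] scaleC_C0.rep_eq intro!: C0_eqI)

lemma norm_mult_C0: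
  assumes m: "continuous_on UNIV m" "\<And>x. cmod (m x) \<le> 1"
  shows "norm (mult_C0 m) \<le> 1"
proof (rule norm_blinfun_bound)
  fix f :: "'a C0"
  show "norm (blinfun_apply (mult_C0 m) f) \<le> 1 * norm f"
  proof (rule norm_C0_le)
    fix x
    show "cmod (apply_C0 (blinfun_apply (mult_C0 m) f) x) \<le> 1 * norm f"
      using mult_mono[OF m(2)[of x] norm_apply_C0_le[of f x]]
      by (simp add: apply_mult_C0[OF m] norm_mult)
  qed
qed simp

text \<open>Continuous and piecewise linear, climbing from \<open>0\<close> at \<open>1 - 2 \<beta>\<close> to \<open>1\<close> at \<open>1 - \<beta>\<close>.  Multiplying by
  \<open>cutoff \<beta> |f|\<close> plays the part that restriction to the set where \<open>|f|\<close> is almost \<open>1\<close> would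
  play for measurable functions.\<close>

definition cutoff :: "real \<Rightarrow> real \<Rightarrow> real" where
  "cutoff \<beta> t = min 1 (max 0 ((t - (1 - 2 * \<beta>)) / \<beta>))"

lemma cutoff_range: "0 \<le> cutoff \<beta> t" "cutoff \<beta> t \<le> 1"
  by (simp_all add: cutoff_def)

lemma cutoff_eq_0: "\<beta> > 0 \<Longrightarrow> t \<le> 1 - 2 * \<beta> \<Longrightarrow> cutoff \<beta> t = 0"
  by (simp add: cutoff_def divide_le_0_iff)

lemma cutoff_eq_1: "\<beta> > 0 \<Longrightarrow> 1 - \<beta> \<le> t \<Longrightarrow> cutoff \<beta> t = 1"
  by (simp add: cutoff_def field_simps)

lemma continuous_on_cutoff [continuous_intros]:
  "\<beta> > 0 \<Longrightarrow> continuous_on A f \<Longrightarrow> continuous_on A (\<lambda>x. cutoff \<beta> (f x))"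
  unfolding cutoff_def by (intro continuous_intros) auto

text \<open>Where \<open>|p| \<le> 1 - \<beta>\<close> there is room to add \<open>w \<beta> h\<close> for every unimodular \<open>w\<close> without leaving
  the unit ball, so uniform convexity at \<open>R p\<close> makes \<open>R (\<beta> h)\<close> small.\<close>

lemma small_off_peak:
  assumes ucx: "complex_uniformly_convex TYPE('y::complex_normed_vector)"
    and \<beta>: "\<beta> > 0" and \<epsilon>: "\<epsilon> > 0"
  obtains \<delta> where "\<delta> > 0"
    "\<And>(R :: 'l::topological_space C0 \<Rightarrow>\<^sub>L 'y) p h.
      \<lbrakk>R \<in> complex_operators; norm R \<le> 1; norm p \<le> 1; 1 - \<delta> \<le> norm (blinfun_apply R p);
        norm h \<le> 1; \<And>x. apply_C0 h x \<noteq> 0 \<Longrightarrow> cmod (apply_C0 p x) \<le> 1 - \<beta>\<rbrakk>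
      \<Longrightarrow> norm (blinfun_apply R h) \<le> \<epsilon>"
proof -
  obtain \<delta> where \<delta>: "\<delta> > 0" "\<And>y0 y1 :: 'y. \<lbrakk>\<And>w. cmod w = 1 \<Longrightarrow> norm (y0 + w *\<^sub>C y1) \<le> 1;
      norm y1 > \<beta> * \<epsilon>\<rbrakk> \<Longrightarrow> norm y0 < 1 - \<delta>"
    using ucx mult_pos_pos[OF \<beta> \<epsilon>] unfolding complex_uniformly_convex_def by metis
  show ?thesis
  proof (rule that[OF \<delta>(1)])
    fix R :: "'l C0 \<Rightarrow>\<^sub>L 'y" and p h
    assume R: "R \<in> complex_operators" "norm R \<le> 1" and p: "norm p \<le> 1"
      and Rp: "1 - \<delta> \<le> norm (blinfun_apply R p)" and h: "norm h \<le> 1"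
      and off: "\<And>x. apply_C0 h x \<noteq> 0 \<Longrightarrow> cmod (apply_C0 p x) \<le> 1 - \<beta>"
    have "norm (blinfun_apply R p + w *\<^sub>C blinfun_apply R (\<beta> *\<^sub>R h)) \<le> 1" if w: "cmod w = 1" for w
    proof -
      have "norm (p + w *\<^sub>C (\<beta> *\<^sub>R h)) \<le> 1"
      proof (rule norm_C0_le)
        fix x
        have eq: "apply_C0 (p + w *\<^sub>C (\<beta> *\<^sub>R h)) x = apply_C0 p x + w * (\<beta> * apply_C0 h x)"
          by (simp add: plus_C0.rep_eq scaleC_C0.rep_eq apply_C0_scaleR)
        show "cmod (apply_C0 (p + w *\<^sub>C (\<beta> *\<^sub>R h)) x) \<le> 1"
        proof (cases "apply_C0 h x = 0")
          case True
          then show ?thesis using norm_apply_C0_le[of p x] p unfolding eq by simp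
        next
          case False
          have "cmod (w * (\<beta> * apply_C0 h x)) \<le> \<beta> * 1"
            using norm_apply_C0_le[of h x] h \<beta> w unfolding norm_mult
            by (simp add: mult_left_le)
          then show ?thesis
            using off[OF False] unfolding eq by (intro norm_triangle_le) simp
        qed
      qed
      then have "norm (blinfun_apply R (p + w *\<^sub>C (\<beta> *\<^sub>R h))) \<le> 1"
        by (rule norm_blinfun_le_one[OF R(2)])
      then show ?thesis
        by (simp add: blinfun.add_right complex_operators_scaleC[OF R(1)])
    qed
    then have "norm (blinfun_apply R (\<beta> *\<^sub>R h)) \<le> \<beta> * \<epsilon>"
      using \<delta>(2) Rp by (meson not_le)
    then show "norm (blinfun_apply R h) \<le> \<epsilon>"
      using \<beta> by (simp add: blinfun.scaleR_right)
  qed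
qed

text \<open>If \<open>R\<close> almost attains its norm at the midpoint of \<open>p\<close> and \<open>q\<close>, then by the parallelogram law
  \<open>p\<close> and \<open>q\<close> nearly agree wherever the midpoint is close to the unit circle, and the rest of the
  space is almost invisible to \<open>R\<close>.  Passing to a pointwise dominated \<open>d\<close> allows both \<open>p - q\<close>
  itself and all its multiples by functions bounded by one.\<close>

lemma small_on_difference:
  assumes ucx: "complex_uniformly_convex TYPE('y::complex_normed_vector)" and \<epsilon>: "\<epsilon> > 0"
  obtains \<gamma> where "\<gamma> > 0"
    "\<And>(R :: 'l::topological_space C0 \<Rightarrow>\<^sub>L 'y) p q d.
      \<lbrakk>R \<in> complex_operators; norm R \<le> 1; norm p \<le> 1; norm q \<le> 1;
        2 * (1 - \<gamma>) \<le> norm (blinfun_apply R (p + q));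
        \<And>x. cmod (apply_C0 d x) \<le> cmod (apply_C0 p x - apply_C0 q x)\<rbrakk>
      \<Longrightarrow> norm (blinfun_apply R d) \<le> \<epsilon>"
proof -
  \<comment> \<open>Where \<open>|(p + q) / 2| > 1 - 2 \<beta>\<close>, the parallelogram law bounds \<open>|p - q|\<^sup>2\<close> by \<open>16 \<beta> = (\<epsilon> / 2)\<^sup>2\<close>.\<close>
  define \<beta> where "\<beta> = \<epsilon>\<^sup>2 / 64"
  have \<beta>: "\<beta> > 0" using \<epsilon> by (simp add: \<beta>_def)
  obtain \<gamma> where \<gamma>: "\<gamma> > 0"
    and small: "\<And>(R :: 'l C0 \<Rightarrow>\<^sub>L 'y) p h. \<lbrakk>R \<in> complex_operators; norm R \<le> 1; norm p \<le> 1;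
      1 - \<gamma> \<le> norm (blinfun_apply R p); norm h \<le> 1;
      \<And>x. apply_C0 h x \<noteq> 0 \<Longrightarrow> cmod (apply_C0 p x) \<le> 1 - \<beta>\<rbrakk> \<Longrightarrow> norm (blinfun_apply R h) \<le> \<epsilon> / 4"
    using small_off_peak[OF ucx \<beta>, of "\<epsilon> / 4"] \<epsilon> by auto
  show ?thesis
  proof (rule that[OF \<gamma>])
    fix R :: "'l C0 \<Rightarrow>\<^sub>L 'y" and p q d
    assume R: "R \<in> complex_operators" "norm R \<le> 1" and p: "norm p \<le> 1" and q: "norm q \<le> 1"
      and Rpq: "2 * (1 - \<gamma>) \<le> norm (blinfun_apply R (p + q))"
      and d: "\<And>x. cmod (apply_C0 d x) \<le> cmod (apply_C0 p x - apply_C0 q x)"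
    define mid where "mid = (1/2) *\<^sub>R (p + q)"
    have mid_x: "apply_C0 mid x = (apply_C0 p x + apply_C0 q x) / 2" for x
      by (simp add: mid_def apply_C0_scaleR plus_C0.rep_eq)
    have mid: "norm mid \<le> 1" "1 - \<gamma> \<le> norm (blinfun_apply R mid)"
      using norm_triangle_le[of p q 2] p q Rpq by (simp_all add: mid_def blinfun.scaleR_right)
    define k where "k x = cutoff \<beta> (cmod (apply_C0 mid x))" for x
    have k: "0 \<le> k x" "k x \<le> 1" for x by (simp_all add: k_def cutoff_range)
    have kc: "continuous_on UNIV k"
      unfolding k_def by (intro continuous_intros \<beta> continuous_on_apply_C0)
    \<comment> \<open>\<open>d1\<close> is small in norm, and \<open>d - d1\<close> vanishes near the peak of the midpoint.  The latter has
      norm at most \<open>2\<close>, hence the factor \<open>1/2\<close> in \<open>h\<close> below.\<close>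
    define d1 where "d1 = blinfun_apply (mult_C0 (\<lambda>x. k x)) d"
    have d1_x: "apply_C0 d1 x = k x * apply_C0 d x" for x
      unfolding d1_def by (rule apply_mult_C0[of _ 1]) (use k kc in \<open>auto intro!: continuous_intros\<close>)
    have pq: "(cmod (apply_C0 p x - apply_C0 q x))\<^sup>2 \<le> 4 - 4 * (cmod (apply_C0 mid x))\<^sup>2" for x
    proof -
      have "(cmod (apply_C0 p x - apply_C0 q x))\<^sup>2 + (cmod (apply_C0 p x + apply_C0 q x))\<^sup>2
          = 2 * (cmod (apply_C0 p x))\<^sup>2 + 2 * (cmod (apply_C0 q x))\<^sup>2"
        by (simp only: cmod_power2) (simp add: power2_eq_square algebra_simps)
      moreover have "(cmod (apply_C0 p x))\<^sup>2 \<le> 1" "(cmod (apply_C0 q x))\<^sup>2 \<le> 1"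
        using norm_apply_C0_le[of p x] norm_apply_C0_le[of q x] p q by (simp_all add: power_le_one)
      ultimately show ?thesis
        by (simp add: mid_x norm_divide power_divide)
    qed
    have d1: "norm d1 \<le> \<epsilon> / 2"
    proof (rule norm_C0_le)
      fix x
      show "cmod (apply_C0 d1 x) \<le> \<epsilon> / 2"
      proof (cases "k x = 0")
        case True
        then show ?thesis using \<epsilon> by (simp add: d1_x)
      next
        case False
        then have lb: "1 - 2 * \<beta> < cmod (apply_C0 mid x)"
          using cutoff_eq_0[OF \<beta>] unfolding k_def by (meson not_le)
        have "1 - 4 * \<beta> \<le> (cmod (apply_C0 mid x))\<^sup>2"
        proof (cases "0 \<le> 1 - 2 * \<beta>")
          case True
          have "(1 - 2 * \<beta>)\<^sup>2 \<le> (cmod (apply_C0 mid x))\<^sup>2"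
            using lb True by (intro power_mono) auto
          moreover have "(1 - 2 * \<beta>)\<^sup>2 = 1 - 4 * \<beta> + 4 * \<beta>\<^sup>2"
            by (simp add: power2_eq_square algebra_simps)
          ultimately show ?thesis using zero_le_power2[of \<beta>] by linarith
        next
          case False
          then show ?thesis using zero_le_power2[of "cmod (apply_C0 mid x)"] by linarith
        qed
        then have "(cmod (apply_C0 p x - apply_C0 q x))\<^sup>2 \<le> (\<epsilon> / 2)\<^sup>2"
          using pq[of x] by (simp add: \<beta>_def power_divide)
        then have "cmod (apply_C0 p x - apply_C0 q x) \<le> \<epsilon> / 2"
          by (rule power2_le_imp_le) (use \<epsilon> in simp)
        moreover have "cmod (apply_C0 d1 x) \<le> cmod (apply_C0 d x)"
          using k[of x] by (simp add: d1_x norm_mult mult_left_le_one_le)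
        ultimately show ?thesis using d[of x] by linarith
      qed
    qed
    have Rd1: "norm (blinfun_apply R d1) \<le> \<epsilon> / 2"
    proof -
      have "norm (blinfun_apply R d1) \<le> 1 * norm d1"
        using norm_blinfun[of R d1] mult_right_mono[OF R(2) norm_ge_zero[of d1]] by linarith
      then show ?thesis using d1 by simp
    qed
    define h where "h = (1/2) *\<^sub>R (d - d1)"
    have h_x: "apply_C0 h x = (1 - k x) * apply_C0 d x / 2" for x
      by (simp add: h_def apply_C0_scaleR minus_C0.rep_eq d1_x algebra_simps)
    have "norm (blinfun_apply R h) \<le> \<epsilon> / 4"
    proof (rule small[OF R mid])
      show "norm h \<le> 1"
      proof (rule norm_C0_le)
        fix x
        have "cmod (apply_C0 d x) \<le> 2"
          using d[of x] norm_triangle_ineq4[of "apply_C0 p x" "apply_C0 q x"]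
            norm_apply_C0_le[of p x] norm_apply_C0_le[of q x] p q by linarith
        moreover have "cmod (apply_C0 h x) = (1 - k x) * (cmod (apply_C0 d x) / 2)"
        proof -
          have "cmod (1 - complex_of_real (k x)) = 1 - k x"
            using k[of x] by (metis abs_of_nonneg diff_ge_0_iff_ge norm_of_real of_real_1 of_real_diff)
          then show ?thesis by (simp add: h_x norm_mult norm_divide)
        qed
        ultimately show "cmod (apply_C0 h x) \<le> 1"
          using k[of x] mult_mono[of "1 - k x" 1 "cmod (apply_C0 d x) / 2" 1] by simp
      qed
      fix x assume "apply_C0 h x \<noteq> 0"
      then have "k x \<noteq> 1" by (auto simp: h_x)
      then show "cmod (apply_C0 mid x) \<le> 1 - \<beta>"
        using cutoff_eq_1[OF \<beta>] unfolding k_def by (meson linear)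
    qed
    moreover have "d = d1 + 2 *\<^sub>R h" by (simp add: h_def)
    ultimately show "norm (blinfun_apply R d) \<le> \<epsilon>"
      using Rd1 norm_triangle_ineq[of "blinfun_apply R d1" "blinfun_apply R (2 *\<^sub>R h)"]
      by (simp add: blinfun.add_right blinfun.scaleR_right)
  qed
qed

section \<open>Stretching towards a point of the range\<close>

text \<open>For \<open>\<psi>\<close> of norm one attaining its norm at a unit vector \<open>y\<close>, a vector in the unit ball reaches
  the maximal norm \<open>1 + \<alpha>\<close> only if \<open>\<psi>\<close> is unimodular on it.  Composing with this map therefore
  forces maximising sequences of an operator to nearly maximise a scalar functional as well, while
  moving the operator by at most \<open>\<alpha>\<close>.\<close>

definition stretch ::
    "real \<Rightarrow> ('y::complex_normed_vector \<Rightarrow> complex) \<Rightarrow> 'y \<Rightarrow> 'y \<Rightarrow>\<^sub>L 'y" where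
  "stretch \<alpha> \<psi> y = Blinfun (\<lambda>z. z + (complex_of_real \<alpha> * \<psi> z) *\<^sub>C y)"

lemma norming_functional_add: "norming_functional \<psi> y \<Longrightarrow> \<psi> (u + v) = \<psi> u + \<psi> v"
  and norming_functional_scaleC: "norming_functional \<psi> y \<Longrightarrow> \<psi> (c *\<^sub>C u) = c * \<psi> u"
  and norming_functional_le: "norming_functional \<psi> y \<Longrightarrow> cmod (\<psi> u) \<le> norm u"
  and norming_functional_attains: "norming_functional \<psi> y \<Longrightarrow> \<psi> y = complex_of_real (norm y)"
  by (simp_all add: norming_functional_def)

context
  fixes \<psi> and y :: "'y::complex_normed_vector" and \<alpha> :: real
  assumes \<psi>: "norming_functional \<psi> y" and y: "norm y = 1" and \<alpha>: "\<alpha> \<ge> 0"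
begin

lemma stretch_apply: "blinfun_apply (stretch \<alpha> \<psi> y) z = z + (complex_of_real \<alpha> * \<psi> z) *\<^sub>C y"
proof -
  have "bounded_linear (\<lambda>z. z + (complex_of_real \<alpha> * \<psi> z) *\<^sub>C y)"
  proof (rule bounded_linear_intro[of _ "1 + \<alpha>"])
    fix u v and r :: real
    show "u + v + (complex_of_real \<alpha> * \<psi> (u + v)) *\<^sub>C y =
        u + (complex_of_real \<alpha> * \<psi> u) *\<^sub>C y + (v + (complex_of_real \<alpha> * \<psi> v) *\<^sub>C y)"
      by (simp add: norming_functional_add[OF \<psi>] distrib_left scaleC_add_left)
    show "r *\<^sub>R u + (complex_of_real \<alpha> * \<psi> (r *\<^sub>R u)) *\<^sub>C y =
        r *\<^sub>R (u + (complex_of_real \<alpha> * \<psi> u) *\<^sub>C y)"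
      by (simp add: scaleR_scaleC norming_functional_scaleC[OF \<psi>] scaleC_add_right scaleC_scaleC
          mult.left_commute)
    have "norm ((complex_of_real \<alpha> * \<psi> u) *\<^sub>C y) \<le> \<alpha> * norm u"
      using norming_functional_le[OF \<psi>, of u] \<alpha> y by (simp add: norm_scaleC norm_mult mult_left_mono)
    then show "norm (u + (complex_of_real \<alpha> * \<psi> u) *\<^sub>C y) \<le> norm u * (1 + \<alpha>)"
      by (intro norm_triangle_le) (simp add: algebra_simps)
  qed
  then show ?thesis by (simp add: stretch_def bounded_linear_Blinfun_apply)
qed

lemma stretch_complex: "stretch \<alpha> \<psi> y \<in> complex_operators"
  by (simp add: complex_operators_def stretch_apply norming_functional_scaleC[OF \<psi>]
      scaleC_add_right scaleC_scaleC mult.left_commute)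

lemma norm_stretch_diff: "norm (blinfun_apply (stretch \<alpha> \<psi> y) z - z) \<le> \<alpha> * norm z"
  using norming_functional_le[OF \<psi>, of z] \<alpha> y
  by (simp add: stretch_apply norm_scaleC norm_mult mult_left_mono)

lemma norm_stretch_le: "norm (blinfun_apply (stretch \<alpha> \<psi> y) z) \<le> norm z + \<alpha> * cmod (\<psi> z)"
  unfolding stretch_apply using \<alpha> y by (intro norm_triangle_le) (simp add: norm_scaleC norm_mult)

lemma norm_stretch_le': "norm (blinfun_apply (stretch \<alpha> \<psi> y) z) \<le> (1 + \<alpha>) * norm z"
  using norm_stretch_le[of z] mult_left_mono[OF norming_functional_le[OF \<psi>, of z] \<alpha>]
  by (simp add: algebra_simps)

lemma stretch_ray: "blinfun_apply (stretch \<alpha> \<psi> y) (r *\<^sub>R y) = ((1 + \<alpha>) * r) *\<^sub>R y"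
proof -
  have "\<psi> (r *\<^sub>R y) = complex_of_real r"
    by (simp add: scaleR_scaleC norming_functional_scaleC[OF \<psi>] norming_functional_attains[OF \<psi>] y)
  then show ?thesis
    by (simp add: stretch_apply scaleR_scaleC distrib_right flip: scaleC_add_left)
qed

end

lemma bounded_bilinear_scaleC:
  "bounded_bilinear (scaleC :: complex \<Rightarrow> 'y::complex_normed_vector \<Rightarrow> 'y)"
  by unfold_locales
    (auto simp: scaleC_add_left scaleC_add_right scaleR_scaleC scaleC_scaleC norm_scaleC
      scaleR_conv_of_real mult.commute intro!: exI[of _ 1])

text \<open>Stretching an operator towards a value \<open>T f\<close> at which it attains its norm makes it range
  strongly exposing: along a maximising sequence \<open>\<psi> (T x)\<close> must tend to the unit circle, so that
  after a rotation of \<open>x\<close> the operator \<open>T\<close> almost attains its norm at the midpoint of \<open>f\<close> and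
  \<open>x\<close>.\<close>

theorem stretch_range_strongly_exposing:
  fixes T :: "'l::topological_space C0 \<Rightarrow>\<^sub>L 'y::complex_normed_vector"
  assumes ucx: "complex_uniformly_convex TYPE('y)"
    and T: "T \<in> complex_operators" "norm T = 1" and f: "norm f = 1" "norm (blinfun_apply T f) = 1"
    and \<psi>: "norming_functional \<psi> (blinfun_apply T f)" and \<alpha>: "\<alpha> > 0"
  defines "S \<equiv> (1 / (1 + \<alpha>)) *\<^sub>R (stretch \<alpha> \<psi> (blinfun_apply T f) o\<^sub>L T)"
  shows "S \<in> range_strongly_exposing" "norm S = 1" "norm (blinfun_apply S f) = 1"
    "norm (S - T) \<le> 2 * \<alpha>"
proof -
  note stretch = stretch_apply[OF \<psi> f(2)] stretch_complex[OF \<psi> f(2)] norm_stretch_le[OF \<psi> f(2)]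
    norm_stretch_le'[OF \<psi> f(2)] stretch_ray[OF \<psi> f(2)] norm_stretch_diff[OF \<psi> f(2)]
  let ?\<Phi> = "stretch \<alpha> \<psi> (blinfun_apply T f)"
  have S_x: "(1 + \<alpha>) *\<^sub>R blinfun_apply S x = blinfun_apply ?\<Phi> (blinfun_apply T x)" for x
    using \<alpha> by (simp add: S_def scaleR_blinfun.rep_eq)
  have T_le: "norm (blinfun_apply T x) \<le> norm x" for x
    using norm_blinfun[of T x] T(2) by simp
  have S_cx: "S \<in> complex_operators"
    unfolding S_def using \<alpha> T(1) by (intro complex_operators_scaleR complex_operators_compose stretch) auto
  have S_f: "blinfun_apply S f = blinfun_apply T f"
    using S_x[of f] stretch(5)[of \<alpha> 1] \<alpha> by simp
  then show Sf: "norm (blinfun_apply S f) = 1" using f by simp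
  have S_le: "(1 + \<alpha>) * norm (blinfun_apply S x) \<le> norm x + \<alpha> * cmod (\<psi> (blinfun_apply T x))" for x
    using stretch(3)[of \<alpha> "blinfun_apply T x"] T_le[of x] \<alpha>
    by (simp flip: S_x)
  show S1: "norm S = 1"
  proof (rule antisym)
    show "norm S \<le> 1"
    proof (rule norm_blinfun_bound)
      fix x
      have "cmod (\<psi> (blinfun_apply T x)) \<le> norm x"
        using norming_functional_le[OF \<psi>] T_le order_trans by blast
      then have "\<alpha> * cmod (\<psi> (blinfun_apply T x)) \<le> \<alpha> * norm x"
        using \<alpha> by simp
      then have "(1 + \<alpha>) * norm (blinfun_apply S x) \<le> (1 + \<alpha>) * norm x"
        using S_le[of x] by (simp add: algebra_simps)
      then show "norm (blinfun_apply S x) \<le> 1 * norm x" using \<alpha> by simp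
    qed simp
    show "1 \<le> norm S" using norm_blinfun[of S f] Sf f by simp
  qed
  show "norm (S - T) \<le> 2 * \<alpha>"
  proof (rule norm_blinfun_bound)
    fix x
    have "(1 + \<alpha>) *\<^sub>R blinfun_apply (S - T) x =
        (blinfun_apply ?\<Phi> (blinfun_apply T x) - blinfun_apply T x) - \<alpha> *\<^sub>R blinfun_apply T x"
      by (simp only: blinfun.diff_left scaleR_diff_right S_x) (simp add: algebra_simps)
    then have "(1 + \<alpha>) * norm (blinfun_apply (S - T) x) \<le>
        \<alpha> * norm (blinfun_apply T x) + \<alpha> * norm (blinfun_apply T x)"
      using norm_triangle_le_diff[of "blinfun_apply ?\<Phi> (blinfun_apply T x) - blinfun_apply T x"
          "\<alpha> *\<^sub>R blinfun_apply T x"] stretch(6)[of \<alpha> "blinfun_apply T x"] \<alpha>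
      by (metis abs_of_pos add_pos_pos add_right_mono less_imp_le norm_scaleR zero_less_one)
    also have "\<dots> \<le> 2 * \<alpha> * norm x"
      using mult_left_mono[OF T_le[of x], of \<alpha>] \<alpha> by simp
    finally have "(1 + \<alpha>) * norm (blinfun_apply (S - T) x) \<le> 2 * \<alpha> * norm x" .
    moreover have "norm (blinfun_apply (S - T) x) \<le> (1 + \<alpha>) * norm (blinfun_apply (S - T) x)"
      using \<alpha> by (simp add: algebra_simps)
    ultimately show "norm (blinfun_apply (S - T) x) \<le> 2 * \<alpha> * norm x" by linarith
  qed (use \<alpha> in simp)
  show "S \<in> range_strongly_exposing"
    unfolding range_strongly_exposing_def mem_Collect_eq
  proof (intro conjI S_cx exI[of _ f] f(1) allI impI)
    fix x :: "nat \<Rightarrow> 'l C0"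
    assume x: "(\<forall>n. norm (x n) \<le> 1) \<and> (\<lambda>n. norm (blinfun_apply S (x n))) \<longlonglongrightarrow> norm S"
    define t where "t n = cmod (\<psi> (blinfun_apply T (x n)))" for n
    have t1: "\<forall>\<^sub>F n in sequentially. 1 - \<gamma> < t n" if "\<gamma> > 0" for \<gamma>
    proof -
      have "1 - \<gamma> * \<alpha> / (1 + \<alpha>) < norm S" using that \<alpha> S1 by simp
      then have "\<forall>\<^sub>F n in sequentially. 1 - \<gamma> * \<alpha> / (1 + \<alpha>) < norm (blinfun_apply S (x n))"
        using x order_tendstoD(1) by blast
      then show ?thesis
      proof eventually_elim
        fix n assume "1 - \<gamma> * \<alpha> / (1 + \<alpha>) < norm (blinfun_apply S (x n))"
        then have "(1 + \<alpha>) * (1 - \<gamma> * \<alpha> / (1 + \<alpha>)) < (1 + \<alpha>) * norm (blinfun_apply S (x n))"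
          using \<alpha> by (intro mult_strict_left_mono) auto
        also have "\<dots> \<le> 1 + \<alpha> * t n"
          using S_le[of "x n"] x unfolding t_def by (smt (verit))
        also have "(1 + \<alpha>) * (1 - \<gamma> * \<alpha> / (1 + \<alpha>)) = 1 + \<alpha> - \<gamma> * \<alpha>"
          using \<alpha> by (simp add: field_simps)
        finally have "\<alpha> * (1 - \<gamma>) < \<alpha> * t n"
          by (simp add: algebra_simps)
        then show "1 - \<gamma> < t n" using \<alpha> by simp
      qed
    qed
    have "\<forall>n. \<exists>c. cmod c = 1 \<and> c * \<psi> (blinfun_apply T (x n)) = complex_of_real (t n)"
      using exists_rotation unfolding t_def by blast
    from choice[OF this] obtain c where c: "\<And>n. cmod (c n) = 1"
      "\<And>n. c n * \<psi> (blinfun_apply T (x n)) = complex_of_real (t n)"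
      by blast
    have "seq_compact (sphere (0::complex) 1)" by (simp add: compact_imp_seq_compact)
    then obtain l \<sigma> where l: "cmod l = 1" and \<sigma>: "strict_mono \<sigma>" and lim: "(c \<circ> \<sigma>) \<longlonglongrightarrow> l"
      unfolding seq_compact_def using c(1) by (metis dist_0_norm mem_sphere)
    define z where "z n = c n *\<^sub>C x n" for n
    have z: "norm (z n) \<le> 1" "\<psi> (blinfun_apply T (z n)) = complex_of_real (t n)" for n
      using x c by (simp_all add: z_def norm_scaleC complex_operators_scaleC[OF T(1)]
          norming_functional_scaleC[OF \<psi>])
    have Tz: "(\<lambda>n. blinfun_apply T (z n)) \<longlonglongrightarrow> blinfun_apply T f"
    proof (rule tendstoI)
      fix e :: real assume e: "e > 0"
      obtain \<gamma> where \<gamma>: "\<gamma> > 0"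
        and small: "\<And>(R :: 'l C0 \<Rightarrow>\<^sub>L 'y) p q d.
          \<lbrakk>R \<in> complex_operators; norm R \<le> 1; norm p \<le> 1; norm q \<le> 1;
            2 * (1 - \<gamma>) \<le> norm (blinfun_apply R (p + q));
            \<And>x. cmod (apply_C0 d x) \<le> cmod (apply_C0 p x - apply_C0 q x)\<rbrakk>
          \<Longrightarrow> norm (blinfun_apply R d) \<le> e / 2"
        using small_on_difference[OF ucx, of "e / 2"] e by (metis half_gt_zero)
      show "\<forall>\<^sub>F n in sequentially. dist (blinfun_apply T (z n)) (blinfun_apply T f) < e"
        using t1[OF \<gamma>]
      proof eventually_elim
        fix n assume n: "1 - \<gamma> < t n"
        have "\<psi> (blinfun_apply T (z n + f)) = complex_of_real (t n + 1)"
          by (simp add: blinfun.add_right norming_functional_add[OF \<psi>] z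
              norming_functional_attains[OF \<psi>] f)
        moreover have "0 \<le> t n" by (simp add: t_def)
        ultimately have "t n + 1 \<le> norm (blinfun_apply T (z n + f))"
          using norming_functional_le[OF \<psi>, of "blinfun_apply T (z n + f)"]
          by (simp only: norm_of_real)
        then have "norm (blinfun_apply T (z n - f)) \<le> e / 2"
          using n \<gamma> z f T by (intro small[of T "z n" f]) (auto simp: minus_C0.rep_eq)
        then show "dist (blinfun_apply T (z n)) (blinfun_apply T f) < e"
          using e by (simp add: dist_norm blinfun.diff_right)
      qed
    qed
    have "(\<lambda>n. blinfun_apply S (z n)) \<longlonglongrightarrow> blinfun_apply S f"
    proof -
      have "(\<lambda>n. (1 / (1 + \<alpha>)) *\<^sub>R blinfun_apply ?\<Phi> (blinfun_apply T (z n)))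
          \<longlonglongrightarrow> (1 / (1 + \<alpha>)) *\<^sub>R blinfun_apply ?\<Phi> (blinfun_apply T f)"
        by (intro tendsto_intros Tz)
      then show ?thesis by (simp add: S_def scaleR_blinfun.rep_eq)
    qed
    then have Sz: "(\<lambda>n. blinfun_apply S (z (\<sigma> n))) \<longlonglongrightarrow> blinfun_apply S f"
      using LIMSEQ_subseq_LIMSEQ[OF _ \<sigma>] by (fastforce simp: o_def)
    have "(\<lambda>n. cnj (c (\<sigma> n)) *\<^sub>C blinfun_apply S (z (\<sigma> n))) \<longlonglongrightarrow> cnj l *\<^sub>C blinfun_apply S f"
      using lim by (intro bounded_bilinear.tendsto[OF bounded_bilinear_scaleC] Sz tendsto_cnj)
        (simp add: o_def)
    moreover have "cnj (c n) *\<^sub>C blinfun_apply S (z n) = blinfun_apply S (x n)" for n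
    proof -
      have "cnj (c n) * c n = 1" using c(1)[of n]
        by (simp add: mult.commute[of "cnj _"] complex_norm_square[symmetric])
      then show ?thesis
        by (simp add: z_def complex_operators_scaleC[OF S_cx] scaleC_scaleC scaleC_one)
    qed
    ultimately have "(\<lambda>n. blinfun_apply S (x (\<sigma> n))) \<longlonglongrightarrow> cnj l *\<^sub>C blinfun_apply S f" by simp
    then show "\<exists>\<sigma> c. strict_mono \<sigma> \<and> cmod c = 1 \<and>
        (\<lambda>n. blinfun_apply S (x (\<sigma> n))) \<longlonglongrightarrow> c *\<^sub>C blinfun_apply S f"
      using \<sigma> l by (intro exI[of _ \<sigma>] exI[of _ "cnj l"]) simp
  qed
qed

section \<open>Localising an operator at a peak and making it attain its norm\<close>

text \<open>Discarding the part of the domain where \<open>|f|\<close> stays away from \<open>1\<close> changes an operator that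
  almost attains its norm at \<open>f\<close> only slightly.  What is left sees \<open>f\<close> only where \<open>|f|\<close> is close
  to \<open>1\<close>, and there it can be replaced by a unimodular function.\<close>

lemma localise_at_peak:
  assumes ucx: "complex_uniformly_convex TYPE('y::complex_normed_vector)"
    and \<gamma>: "0 < \<gamma>" "\<gamma> < 1"
  obtains \<eta> where "\<eta> > 0"
    "\<And>(T :: 'l::topological_space C0 \<Rightarrow>\<^sub>L 'y) f.
      \<lbrakk>T \<in> compact_operators; norm T \<le> 1; norm f = 1; 1 - \<eta> < norm (blinfun_apply T f)\<rbrakk> \<Longrightarrow>
      \<exists>S f0. S \<in> compact_operators \<and> norm S \<le> 1 \<and> norm (S - T) \<le> \<gamma> \<and>
        norm f0 = 1 \<and> norm (f - f0) \<le> \<gamma> \<and> 1 - \<gamma> \<le> norm (blinfun_apply S f0) \<and>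
        (\<forall>h. blinfun_apply S (blinfun_apply (mult_C0 (\<lambda>x. (cmod (apply_C0 f0 x))\<^sup>2)) h)
          = blinfun_apply S h)"
proof -
  define \<beta> where "\<beta> = \<gamma> / 4"
  have \<beta>: "0 < \<beta>" "\<beta> < 1/4" using \<gamma> by (simp_all add: \<beta>_def)
  obtain \<delta> where \<delta>: "\<delta> > 0"
    and small: "\<And>(R :: 'l C0 \<Rightarrow>\<^sub>L 'y) p h. \<lbrakk>R \<in> complex_operators; norm R \<le> 1; norm p \<le> 1;
      1 - \<delta> \<le> norm (blinfun_apply R p); norm h \<le> 1;
      \<And>x. apply_C0 h x \<noteq> 0 \<Longrightarrow> cmod (apply_C0 p x) \<le> 1 - \<beta>\<rbrakk> \<Longrightarrow> norm (blinfun_apply R h) \<le> \<beta>"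
    using small_off_peak[OF ucx \<beta>(1) \<beta>(1)] by blast
  show ?thesis
  proof (rule that[of "min \<beta> \<delta>"])
    show "min \<beta> \<delta> > 0" using \<beta> \<delta> by simp
    fix T :: "'l C0 \<Rightarrow>\<^sub>L 'y" and f
    assume T: "T \<in> compact_operators" "norm T \<le> 1" and f: "norm f = 1"
      and Tf: "1 - min \<beta> \<delta> < norm (blinfun_apply T f)"
    have f_x: "cmod (apply_C0 f x) \<le> 1" for x using norm_apply_C0_le[of f x] f by simp
    have cmod_f: "continuous_on UNIV (\<lambda>x. cmod (apply_C0 f x))"
      by (intro continuous_intros continuous_on_apply_C0)
    define k where "k x = cutoff \<beta> (cmod (apply_C0 f x))" for x
    have k: "0 \<le> k x" "k x \<le> 1" for x by (simp_all add: k_def cutoff_range)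
    have kc: "continuous_on UNIV (\<lambda>x. complex_of_real (k x))"
      unfolding k_def by (intro continuous_intros \<beta> cmod_f)
    have k1: "cmod (complex_of_real (k x)) \<le> 1" for x using k[of x] by simp
    define K where "K = mult_C0 (\<lambda>x. complex_of_real (k x))"
    have K_x: "apply_C0 (blinfun_apply K h) x = k x * apply_C0 h x" for h x
      unfolding K_def by (rule apply_mult_C0[OF kc k1])
    have K: "K \<in> complex_operators" "norm K \<le> 1"
      unfolding K_def by (rule mult_C0_complex[OF kc k1], rule norm_mult_C0[OF kc k1])
    define S where "S = T o\<^sub>L K"
    have S: "S \<in> compact_operators"
      unfolding S_def by (rule compact_operators_compose_right[OF T(1) K])
    have S1: "norm S \<le> 1"
      using norm_blinfun_compose[of T K] mult_mono[OF T(2) K(2)] unfolding S_def by simp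

    have off: "norm (blinfun_apply T (h - blinfun_apply K h)) \<le> \<beta>" if h: "norm h \<le> 1" for h
    proof (rule small[of T f, OF compact_operators_complex[OF T(1)] T(2)])
      have eq: "apply_C0 (h - blinfun_apply K h) x = (1 - k x) * apply_C0 h x" for x
        by (simp add: minus_C0.rep_eq K_x algebra_simps)
      show "norm (h - blinfun_apply K h) \<le> 1"
      proof (rule norm_C0_le)
        fix x
        have "cmod (complex_of_real (1 - k x)) = 1 - k x" using k[of x] by (simp only: norm_of_real)
        then show "cmod (apply_C0 (h - blinfun_apply K h) x) \<le> 1"
          using mult_mono[of "1 - k x" 1 "cmod (apply_C0 h x)" 1] k[of x]
            norm_apply_C0_le[of h x] h by (simp add: eq norm_mult)
      qed
      fix x assume "apply_C0 (h - blinfun_apply K h) x \<noteq> 0"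
      then have "k x \<noteq> 1" by (auto simp: eq)
      then show "cmod (apply_C0 f x) \<le> 1 - \<beta>"
        using cutoff_eq_1[OF \<beta>(1)] unfolding k_def by (meson linear)
    qed (use f Tf in auto)
    have ST: "norm (S - T) \<le> \<beta>"
    proof (rule norm_blinfun_bound)
      fix h :: "'l C0"
      show "norm (blinfun_apply (S - T) h) \<le> \<beta> * norm h"
      proof (cases "h = 0")
        case False
        define u where "u = h /\<^sub>R norm h"
        have u: "h = norm h *\<^sub>R u" "norm u = 1" using False by (simp_all add: u_def)
        have "norm (blinfun_apply (S - T) u) \<le> \<beta>"
          using off[of u] u(2)
          by (simp add: S_def blinfun.diff_left blinfun.diff_right norm_minus_commute)
        then show ?thesis
          using mult_left_mono[of "norm (blinfun_apply (S - T) u)" \<beta> "norm h"]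
          by (subst u(1)) (simp add: blinfun.scaleR_right mult.commute)
      qed simp
    qed (use \<beta> in simp)

    define s where "s = 1 - 2 * \<beta>"
    have s: "1/2 < s" "s < 1" using \<beta> by (simp_all add: s_def)
    \<comment> \<open>\<open>f0 = f / max |f| s\<close> is unimodular exactly where \<open>|f| \<ge> s\<close>, a set that contains the support
      of the cutoff.\<close>
    define m where "m x = complex_of_real (1 / max (cmod (apply_C0 f x)) s)" for x
    have mc: "continuous_on UNIV m"
      unfolding m_def by (intro continuous_intros cmod_f) (use s in \<open>auto simp: max_def\<close>)
    have m2: "cmod (m x) \<le> 2" for x
    proof -
      have "1/2 < max (cmod (apply_C0 f x)) s" using s by simp
      then show ?thesis by (simp add: m_def norm_divide field_simps)
    qed
    define f0 where "f0 = blinfun_apply (mult_C0 m) f"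
    have f0_x: "apply_C0 f0 x = m x * apply_C0 f x" for x
      unfolding f0_def by (rule apply_mult_C0[OF mc m2])
    have cmod_f0: "cmod (apply_C0 f0 x) = cmod (apply_C0 f x) / max (cmod (apply_C0 f x)) s" for x
      using s by (simp add: f0_x m_def norm_mult norm_divide)
    have f0_le: "cmod (apply_C0 f0 x) \<le> 1" for x
      using s by (simp add: cmod_f0 divide_le_eq)
    have f0_peak: "cmod (apply_C0 f0 x) = 1" if "s < cmod (apply_C0 f x)" for x
    proof -
      have "max (cmod (apply_C0 f x)) s = cmod (apply_C0 f x)" using that by simp
      moreover have "cmod (apply_C0 f x) \<noteq> 0" using that s by linarith
      ultimately show ?thesis by (simp only: cmod_f0) simp
    qed
    have f0: "norm f0 = 1"
    proof (rule antisym)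
      show "norm f0 \<le> 1" by (rule norm_C0_le) (rule f0_le)
      have "\<exists>x. s < cmod (apply_C0 f x)"
      proof (rule ccontr)
        assume "\<nexists>x. s < cmod (apply_C0 f x)"
        then have "norm f \<le> s" by (intro norm_C0_le) (simp add: not_less)
        then show False using f s by simp
      qed
      then show "1 \<le> norm f0" using f0_peak norm_apply_C0_le by metis
    qed
    have ff0: "norm (f - f0) \<le> 2 * \<beta>"
    proof (rule norm_C0_le)
      fix x
      let ?M = "max (cmod (apply_C0 f x)) s"
      have M: "s \<le> ?M" "?M \<le> 1" "cmod (apply_C0 f x) \<le> ?M" "0 < ?M" using f_x[of x] s by auto
      have "apply_C0 (f - f0) x = complex_of_real (1 - 1 / ?M) * apply_C0 f x"
        by (simp add: minus_C0.rep_eq f0_x m_def algebra_simps)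
      then have "cmod (apply_C0 (f - f0) x) = \<bar>1 - 1 / ?M\<bar> * cmod (apply_C0 f x)"
        by (simp only: norm_mult norm_of_real)
      also have "\<bar>1 - 1 / ?M\<bar> = (1 - ?M) / ?M"
      proof -
        have "1 \<le> 1 / ?M" using M by (simp add: le_divide_eq)
        then have "\<bar>1 - 1 / ?M\<bar> = 1 / ?M - 1" by linarith
        also have "\<dots> = (1 - ?M) / ?M" using M(4) by (simp only: diff_divide_distrib) simp
        finally show ?thesis .
      qed
      also have "(1 - ?M) / ?M * cmod (apply_C0 f x) = (1 - ?M) * (cmod (apply_C0 f x) / ?M)" by simp
      also have "\<dots> \<le> (1 - ?M) * 1"
        using M by (intro mult_left_mono) (auto simp: divide_le_eq)
      also have "\<dots> \<le> 2 * \<beta>" using M by (simp add: s_def)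
      finally show "cmod (apply_C0 (f - f0) x) \<le> 2 * \<beta>" .
    qed
    have Sf0: "1 - \<gamma> \<le> norm (blinfun_apply S f0)"
    proof -
      have "norm (blinfun_apply T f) \<le> norm (blinfun_apply T f - blinfun_apply S f) +
          norm (blinfun_apply S (f - f0)) + norm (blinfun_apply S f0)"
        using norm_triangle_ineq[of "blinfun_apply T f - blinfun_apply S f" "blinfun_apply S f"]
          norm_triangle_ineq[of "blinfun_apply S (f - f0)" "blinfun_apply S f0"]
        by (simp add: blinfun.diff_right)
      moreover have "norm (blinfun_apply T f - blinfun_apply S f) \<le> \<beta>"
        using norm_blinfun[of "S - T" f] ST f by (simp add: blinfun.diff_left norm_minus_commute)
      moreover have "norm (blinfun_apply S (f - f0)) \<le> 2 * \<beta>"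
        using norm_blinfun[of S "f - f0"] mult_mono[OF S1 ff0] \<beta> by simp
      ultimately show ?thesis using Tf by (simp add: \<beta>_def)
    qed
    have live: "blinfun_apply S (blinfun_apply (mult_C0 (\<lambda>x. (cmod (apply_C0 f0 x))\<^sup>2)) h)
        = blinfun_apply S h" for h
    proof -
      have "blinfun_apply K (blinfun_apply (mult_C0 (\<lambda>x. (cmod (apply_C0 f0 x))\<^sup>2)) h) = blinfun_apply K h"
      proof (rule C0_eqI)
        fix x
        have "apply_C0 (blinfun_apply (mult_C0 (\<lambda>x. (cmod (apply_C0 f0 x))\<^sup>2)) h) x
            = (cmod (apply_C0 f0 x))\<^sup>2 * apply_C0 h x"
          by (rule apply_mult_C0[of _ 1])
            (auto intro!: continuous_intros continuous_on_apply_C0 simp: norm_power power_le_one f0_le)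
        moreover have "k x = 0 \<or> cmod (apply_C0 f0 x) = 1"
          using f0_peak[of x] cutoff_eq_0[OF \<beta>(1)] unfolding k_def s_def by (meson not_le)
        ultimately show "apply_C0 (blinfun_apply K (blinfun_apply
            (mult_C0 (\<lambda>x. (cmod (apply_C0 f0 x))\<^sup>2)) h)) x = apply_C0 (blinfun_apply K h) x"
          by (auto simp: K_x)
      qed
      then show ?thesis by (simp add: S_def)
    qed
    show "\<exists>S f0. S \<in> compact_operators \<and> norm S \<le> 1 \<and> norm (S - T) \<le> \<gamma> \<and>
        norm f0 = 1 \<and> norm (f - f0) \<le> \<gamma> \<and> 1 - \<gamma> \<le> norm (blinfun_apply S f0) \<and>
        (\<forall>h. blinfun_apply S (blinfun_apply (mult_C0 (\<lambda>x. (cmod (apply_C0 f0 x))\<^sup>2)) h)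
          = blinfun_apply S h)"
      using S S1 ST f0 ff0 Sf0 live \<beta>(1)
      by (intro exI[of _ S] exI[of _ f0]) (auto simp: \<beta>_def)
  qed
qed

lemma exists_almost_maximiser:
  assumes "t > 0"
  obtains x where "norm x \<le> 1" "norm T - t < norm (blinfun_apply T x)"
proof (rule ccontr)
  assume "\<not> thesis"
  then have *: "norm (blinfun_apply T x) \<le> norm T - t" if "norm x \<le> 1" for x
    using that \<open>\<not> thesis\<close> \<open>\<And>x. \<lbrakk>norm x \<le> 1; norm T - t < norm (blinfun_apply T x)\<rbrakk> \<Longrightarrow> thesis\<close>
    by (meson not_le)
  have "norm T \<le> norm T - t"
  proof (rule norm_blinfun_bound)
    show "0 \<le> norm T - t" using *[of 0] by simp
    fix x
    show "norm (blinfun_apply T x) \<le> (norm T - t) * norm x"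
    proof (cases "x = 0")
      case False
      then show ?thesis using *[of "x /\<^sub>R norm x"] by (simp add: blinfun.scaleR_right field_simps)
    qed simp
  qed
  then show False using assms by simp
qed

text \<open>After stretching towards \<open>S f0\<close>, every almost maximising \<open>g\<close> is, up to rotation, close to
  \<open>f0\<close> as far as \<open>S\<close> can see.  Composing with multiplication by \<open>cnj f0 * g\<close> is therefore a small
  change, and it moves the value at \<open>g\<close> to the fixed point \<open>f0\<close>.  A pointwise limit along a
  maximising sequence then attains its norm at \<open>f0\<close>.\<close>

lemma attain_at_peak:
  assumes ucx: "complex_uniformly_convex TYPE('y::complex_normed_vector)"
    and \<alpha>: "0 < \<alpha>" "\<alpha> \<le> 1"
  obtains \<gamma> where "0 < \<gamma>" "\<gamma> \<le> \<alpha>" "\<gamma> < 1"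
    "\<And>(S :: 'l::topological_space C0 \<Rightarrow>\<^sub>L 'y) f0.
      \<lbrakk>S \<in> compact_operators; norm S \<le> 1; norm f0 = 1; 1 - \<gamma> \<le> norm (blinfun_apply S f0);
        \<And>h. blinfun_apply S (blinfun_apply (mult_C0 (\<lambda>x. (cmod (apply_C0 f0 x))\<^sup>2)) h)
          = blinfun_apply S h\<rbrakk> \<Longrightarrow>
      \<exists>R \<in> compact_operators. norm R = 1 \<and> norm (blinfun_apply R f0) = 1 \<and> norm (R - S) \<le> 4 * \<alpha>"
proof -
  obtain \<gamma>0 where \<gamma>0: "\<gamma>0 > 0"
    and small: "\<And>(R :: 'l C0 \<Rightarrow>\<^sub>L 'y) p q d.
      \<lbrakk>R \<in> complex_operators; norm R \<le> 1; norm p \<le> 1; norm q \<le> 1;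
        2 * (1 - \<gamma>0) \<le> norm (blinfun_apply R (p + q));
        \<And>x. cmod (apply_C0 d x) \<le> cmod (apply_C0 p x - apply_C0 q x)\<rbrakk>
      \<Longrightarrow> norm (blinfun_apply R d) \<le> \<alpha>"
    using small_on_difference[OF ucx \<alpha>(1)] by blast
  \<comment> \<open>An error \<open>\<gamma>\<close> in the norm of the stretched operator costs up to \<open>3 \<gamma> / \<alpha>\<close> in the scalar
    functional, which must stay below \<open>\<gamma>0\<close>.\<close>
  define \<gamma> where "\<gamma> = min (\<alpha> / 2) (\<gamma>0 * \<alpha> / 3)"
  have \<gamma>: "0 < \<gamma>" "\<gamma> \<le> \<alpha> / 2" "3 * \<gamma> \<le> \<gamma>0 * \<alpha>"
    using \<alpha> \<gamma>0 by (auto simp: \<gamma>_def min_def)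
  have \<gamma>_le: "\<gamma> \<le> \<gamma>0"
  proof -
    have "\<gamma>0 * \<alpha> \<le> \<gamma>0 * 1" using \<alpha> \<gamma>0 by (intro mult_left_mono) auto
    then show ?thesis using \<gamma> \<alpha> by linarith
  qed
  show ?thesis
  proof (rule that[of \<gamma>])
    show "0 < \<gamma>" "\<gamma> \<le> \<alpha>" "\<gamma> < 1" using \<gamma> \<alpha> by auto
    fix S :: "'l C0 \<Rightarrow>\<^sub>L 'y" and f0
    assume S: "S \<in> compact_operators" "norm S \<le> 1" and f0: "norm f0 = 1"
      and Sf0: "1 - \<gamma> \<le> norm (blinfun_apply S f0)"
      and live: "\<And>h. blinfun_apply S (blinfun_apply (mult_C0 (\<lambda>x. (cmod (apply_C0 f0 x))\<^sup>2)) h)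
          = blinfun_apply S h"
    note Sc = compact_operators_complex[OF S(1)]
    define r where "r = norm (blinfun_apply S f0)"
    have r: "0 < r" "1 - \<gamma> \<le> r" using Sf0 \<gamma> \<alpha> unfolding r_def by linarith+
    define y where "y = blinfun_apply S f0 /\<^sub>R r"
    have y: "norm y = 1" and ry: "blinfun_apply S f0 = r *\<^sub>R y"
      using r by (simp_all add: y_def r_def)
    obtain \<psi> where \<psi>: "norming_functional \<psi> y" using norming_functional_exists by blast
    have \<alpha>0: "0 \<le> \<alpha>" using \<alpha> by simp
    define \<Phi> where "\<Phi> = stretch \<alpha> \<psi> y"
    note stretch = stretch_complex[OF \<psi> y \<alpha>0, folded \<Phi>_def] norm_stretch_le[OF \<psi> y \<alpha>0, folded \<Phi>_def]
      norm_stretch_le'[OF \<psi> y \<alpha>0, folded \<Phi>_def] stretch_ray[OF \<psi> y \<alpha>0, folded \<Phi>_def]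
      norm_stretch_diff[OF \<psi> y \<alpha>0, folded \<Phi>_def]
    define S1 where "S1 = \<Phi> o\<^sub>L S"
    have S1_x: "blinfun_apply S1 h = blinfun_apply \<Phi> (blinfun_apply S h)" for h
      by (simp add: S1_def)
    have S1c: "S1 \<in> compact_operators"
      unfolding S1_def by (rule compact_operators_compose_left[OF stretch(1) S(1)])
    have S_le: "norm (blinfun_apply S h) \<le> norm h" for h
      using norm_blinfun[of S h] mult_right_mono[OF S(2) norm_ge_zero[of h]] by linarith
    define N where "N = norm S1"
    have N_le: "N \<le> 1 + \<alpha>"
      unfolding N_def
    proof (rule norm_blinfun_bound)
      fix h
      show "norm (blinfun_apply S1 h) \<le> (1 + \<alpha>) * norm h"
        unfolding S1_x using \<alpha>
        by (intro order_trans[OF stretch(3)] mult_left_mono S_le) simp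
    qed (use \<alpha> in simp)
    have N_ge: "(1 + \<alpha>) * (1 - \<gamma>) \<le> N"
    proof -
      have "(1 + \<alpha>) * (1 - \<gamma>) \<le> (1 + \<alpha>) * r" using r \<alpha> by simp
      also have "\<dots> = norm (blinfun_apply S1 f0)"
        using \<alpha> r y by (simp add: S1_x ry stretch(4))
      also have "\<dots> \<le> N" using norm_blinfun[of S1 f0] f0 by (simp add: N_def)
      finally show ?thesis .
    qed
    have "1 - \<alpha> \<le> N"
    proof -
      have "(1 + \<alpha>) * (1 - \<gamma>) = 1 - \<gamma> + \<alpha> * (1 - \<gamma>)" by (simp add: algebra_simps)
      moreover have "0 \<le> \<alpha> * (1 - \<gamma>)" using \<gamma> \<alpha> by simp
      ultimately show ?thesis using N_ge \<gamma> \<alpha> by linarith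
    qed
    have N0: "0 < N" using N_ge \<gamma> \<alpha> mult_pos_pos[of "1 + \<alpha>" "1 - \<gamma>"] by linarith

    have "\<exists>g. norm g \<le> 1 \<and> N - \<alpha> * \<gamma> / Suc n < norm (blinfun_apply S1 g) \<and>
        1 - \<gamma>0 \<le> Re (\<psi> (blinfun_apply S g))" for n
    proof -
      have t: "0 < \<alpha> * \<gamma> / Suc n" using \<alpha> \<gamma> by simp
      obtain g where g: "norm g \<le> 1" "N - \<alpha> * \<gamma> / Suc n < norm (blinfun_apply S1 g)"
        using exists_almost_maximiser[OF t, of S1] unfolding N_def by blast
      obtain c where c: "cmod c = 1"
        "c * \<psi> (blinfun_apply S g) = complex_of_real (cmod (\<psi> (blinfun_apply S g)))"
        using exists_rotation by blast
      have "\<alpha> * \<gamma> / Suc n \<le> \<alpha> * \<gamma>" using \<alpha> \<gamma> by (simp add: divide_le_eq)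
      then have "(1 + \<alpha>) * (1 - \<gamma>) - \<alpha> * \<gamma> < 1 + \<alpha> * cmod (\<psi> (blinfun_apply S g))"
        using g N_ge stretch(2)[of "blinfun_apply S g"] S_le[of g] by (simp add: S1_x)
      moreover have "\<alpha> * \<gamma> \<le> \<gamma>" using \<alpha> \<gamma> by simp
      ultimately have "\<alpha> - 3 * \<gamma> < \<alpha> * cmod (\<psi> (blinfun_apply S g))"
        by (simp add: algebra_simps)
      then have "\<alpha> * (1 - \<gamma>0) < \<alpha> * cmod (\<psi> (blinfun_apply S g))"
        using \<gamma> by (simp add: algebra_simps)
      then have "1 - \<gamma>0 < cmod (\<psi> (blinfun_apply S g))" using \<alpha> by simp
      then show ?thesis
        using g c
        by (intro exI[of _ "c *\<^sub>C g"])
          (simp add: norm_scaleC complex_operators_scaleC[OF Sc]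
            complex_operators_scaleC[OF compact_operators_complex[OF S1c]] norming_functional_scaleC[OF \<psi>])
    qed
    then obtain g where g: "\<And>n. norm (g n) \<le> 1"
      and gmax: "\<And>n. N - \<alpha> * \<gamma> / Suc n < norm (blinfun_apply S1 (g n))"
      and g\<psi>: "\<And>n. 1 - \<gamma>0 \<le> Re (\<psi> (blinfun_apply S (g n)))"
      by metis

    define u where "u n x = cnj (apply_C0 f0 x) * apply_C0 (g n) x" for n x
    have f0_x: "cmod (apply_C0 f0 x) \<le> 1" for x using norm_apply_C0_le[of f0 x] f0 by simp
    have u: "continuous_on UNIV (u n)" "\<And>x. cmod (u n x) \<le> 1" for n
    proof -
      show "continuous_on UNIV (u n)"
        unfolding u_def by (intro continuous_intros continuous_on_apply_C0)
      fix x
      have "cmod (apply_C0 (g n) x) \<le> 1" using norm_apply_C0_le[of "g n" x] g[of n] by simp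
      then show "cmod (u n x) \<le> 1"
        using mult_mono[OF f0_x[of x]] unfolding u_def norm_mult by fastforce
    qed
    have sq: "apply_C0 (blinfun_apply (mult_C0 (\<lambda>x. (cmod (apply_C0 f0 x))\<^sup>2)) h) x
        = (cmod (apply_C0 f0 x))\<^sup>2 * apply_C0 h x" for h x
      by (rule apply_mult_C0[of _ 1])
        (auto intro!: continuous_intros continuous_on_apply_C0 simp: norm_power power_le_one f0_x)
    define R where "R n = S1 o\<^sub>L mult_C0 (u n)" for n
    have R_x: "blinfun_apply (R n) h = blinfun_apply S1 (blinfun_apply (mult_C0 (u n)) h)" for n h
      by (simp add: R_def)
    have Rc: "R n \<in> complex_operators" for n
      unfolding R_def
      by (intro complex_operators_compose compact_operators_complex S1c mult_C0_complex[OF u])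
    have R_le: "norm (blinfun_apply (R n) h) \<le> N * norm h" for n h
    proof -
      have "norm (R n) \<le> N * 1"
        unfolding R_def N_def
        by (intro order_trans[OF norm_blinfun_compose] mult_left_mono norm_mult_C0 u norm_ge_zero)
      then show ?thesis
        using norm_blinfun[of "R n" h] mult_right_mono[of "norm (R n)" N "norm h"] by simp
    qed

    have close: "norm (blinfun_apply (R n) h - blinfun_apply S1 h) \<le> 2 * \<alpha>" if h: "norm h \<le> 1" for n h
    proof -
      \<comment> \<open>\<open>S\<close> does not distinguish \<open>h\<close> from \<open>|f0|\<^sup>2 h\<close>, and \<open>cnj f0 g h - |f0|\<^sup>2 h = h (cnj f0) (g - f0)\<close>.\<close>
      define d where "d = blinfun_apply (mult_C0 (u n)) h -
        blinfun_apply (mult_C0 (\<lambda>x. (cmod (apply_C0 f0 x))\<^sup>2)) h"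
      have "norm (blinfun_apply S d) \<le> \<alpha>"
      proof (rule small[OF Sc S(2) g[of n]])
        show "norm f0 \<le> 1" using f0 by simp
        have "Re (\<psi> (blinfun_apply S f0)) = r"
          by (simp add: ry scaleR_scaleC norming_functional_scaleC[OF \<psi>]
              norming_functional_attains[OF \<psi>] y)
        then have "2 * (1 - \<gamma>0) \<le> Re (\<psi> (blinfun_apply S (g n + f0)))"
          using g\<psi>[of n] r \<gamma>_le by (simp add: blinfun.add_right norming_functional_add[OF \<psi>])
        also have "\<dots> \<le> norm (blinfun_apply S (g n + f0))"
          using complex_Re_le_cmod norming_functional_le[OF \<psi>] order_trans by blast
        finally show "2 * (1 - \<gamma>0) \<le> norm (blinfun_apply S (g n + f0))" .
        fix x
        have "apply_C0 d x = apply_C0 h x * cnj (apply_C0 f0 x) * (apply_C0 (g n) x - apply_C0 f0 x)"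
          by (simp only: d_def minus_C0.rep_eq apply_mult_C0[OF u] sq)
            (simp only: u_def complex_norm_square, simp add: algebra_simps)
        moreover have "cmod (apply_C0 h x) * cmod (apply_C0 f0 x) \<le> 1"
          using mult_mono[of "cmod (apply_C0 h x)" 1 "cmod (apply_C0 f0 x)" 1]
            norm_apply_C0_le[of h x] h f0_x[of x] by simp
        ultimately show "cmod (apply_C0 d x) \<le> cmod (apply_C0 (g n) x - apply_C0 f0 x)"
          by (simp add: norm_mult mult_left_le_one_le)
      qed
      moreover have "blinfun_apply (R n) h - blinfun_apply S1 h = blinfun_apply \<Phi> (blinfun_apply S d)"
        by (simp only: R_x S1_x d_def blinfun.diff_right live)
      moreover have "(1 + \<alpha>) * norm (blinfun_apply S d) \<le> 2 * norm (blinfun_apply S d)"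
        using \<alpha> by (intro mult_right_mono) auto
      ultimately show ?thesis using stretch(3)[of "blinfun_apply S d"] by simp
    qed
    have R_f0: "blinfun_apply (R n) f0 = blinfun_apply S1 (g n)" for n
    proof -
      have "blinfun_apply (mult_C0 (u n)) f0 =
          blinfun_apply (mult_C0 (\<lambda>x. (cmod (apply_C0 f0 x))\<^sup>2)) (g n)"
        by (rule C0_eqI) (simp only: apply_mult_C0[OF u] sq, simp only: u_def complex_norm_square mult_ac)
      then show ?thesis by (simp only: R_x S1_x live)
    qed

    have RS: "blinfun_apply (R n) ` cball 0 1 \<subseteq> blinfun_apply S1 ` cball 0 1" for n
      using norm_blinfun_le_one[OF norm_mult_C0[OF u]] by (auto simp: R_x intro!: imageI)
    obtain R' where R'c: "R' \<in> compact_operators"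
      and cluster: "\<And>h e N. e > 0 \<Longrightarrow> \<exists>n\<ge>N. norm (blinfun_apply (R n) h - blinfun_apply R' h) < e"
      using compact_operator_cluster_point[of S1 R, OF S1c Rc RS] by blast
    have "norm R' \<le> N"
    proof (rule norm_blinfun_bound)
      fix h
      show "norm (blinfun_apply R' h) \<le> N * norm h"
      proof (rule field_le_epsilon)
        fix e :: real assume "e > 0"
        then obtain n where "norm (blinfun_apply (R n) h - blinfun_apply R' h) < e"
          using cluster by blast
        then show "norm (blinfun_apply R' h) \<le> N * norm h + e"
          using R_le[of n h] norm_triangle_sub[of "blinfun_apply R' h" "blinfun_apply (R n) h"]
          by (simp add: norm_minus_commute)
      qed
    qed (use N0 in simp)
    moreover have R'f0: "N \<le> norm (blinfun_apply R' f0)"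
    proof (rule field_le_epsilon)
      fix e :: real assume e: "e > 0"
      then obtain k where k: "inverse (real (Suc k)) < e / 2" using reals_Archimedean half_gt_zero by blast
      obtain n where n: "n \<ge> k" "norm (blinfun_apply (R n) f0 - blinfun_apply R' f0) < e / 2"
        using cluster half_gt_zero[OF e] by blast
      have "\<alpha> * \<gamma> / Suc n \<le> 1 / Suc k"
        using n(1) \<alpha> \<gamma> mult_mono[of \<alpha> 1 \<gamma> 1] by (intro frac_le) auto
      then show "N \<le> norm (blinfun_apply R' f0) + e"
        using k gmax[of n] n(2) norm_triangle_sub[of "blinfun_apply (R n) f0" "blinfun_apply R' f0"]
        by (simp add: R_f0 inverse_eq_divide)
    qed
    ultimately have R'N: "norm R' = N" "norm (blinfun_apply R' f0) = N"
      using norm_blinfun[of R' f0] f0 by auto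
    have R'S1: "norm (R' - S1) \<le> 2 * \<alpha>"
    proof (rule norm_blinfun_bound)
      fix h :: "'l C0"
      have unit: "norm (blinfun_apply (R' - S1) v) \<le> 2 * \<alpha>" if v: "norm v \<le> 1" for v
      proof (rule field_le_epsilon)
        fix e :: real assume "e > 0"
        then obtain n where "norm (blinfun_apply (R n) v - blinfun_apply R' v) < e"
          using cluster by blast
        then show "norm (blinfun_apply (R' - S1) v) \<le> 2 * \<alpha> + e"
          using close[OF v, of n] norm_triangle_ineq4[of
              "blinfun_apply (R n) v - blinfun_apply S1 v" "blinfun_apply (R n) v - blinfun_apply R' v"]
          by (simp add: blinfun.diff_left)
      qed
      show "norm (blinfun_apply (R' - S1) h) \<le> 2 * \<alpha> * norm h"
      proof (cases "h = 0")
        case False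
        then show ?thesis
          using unit[of "h /\<^sub>R norm h"] by (simp add: blinfun.scaleR_right field_simps)
      qed simp
    qed (use \<alpha> in simp)
    have S1S: "norm (S1 - S) \<le> \<alpha>"
    proof (rule norm_blinfun_bound)
      fix h
      show "norm (blinfun_apply (S1 - S) h) \<le> \<alpha> * norm h"
        using stretch(5)[of "blinfun_apply S h"] mult_left_mono[OF S_le[of h] \<alpha>0]
        by (simp add: blinfun.diff_left S1_x)
    qed (use \<alpha> in simp)
    \<comment> \<open>The budget is \<open>\<alpha>\<close> for normalising, \<open>2 \<alpha>\<close> for the limit and \<open>\<alpha>\<close> for the stretching.\<close>
    define R1 where "R1 = (1 / N) *\<^sub>R R'"
    have R1: "R1 \<in> compact_operators" "norm R1 = 1" "norm (blinfun_apply R1 f0) = 1"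
      using R'N N0 unfolding R1_def
      by (simp_all add: compact_operators_scaleR[OF R'c] scaleR_blinfun.rep_eq)
    have "norm (R' - R1) \<le> \<alpha>"
    proof -
      have "R' - R1 = (N - 1) *\<^sub>R R1"
      proof -
        have "R' = N *\<^sub>R R1" using N0 by (simp add: R1_def)
        then show ?thesis by (simp add: scaleR_left_diff_distrib)
      qed
      then have "norm (R' - R1) = \<bar>N - 1\<bar>" using R1(2) by simp
      then show ?thesis using \<open>1 - \<alpha> \<le> N\<close> N_le by simp
    qed
    then have "norm (R1 - S) \<le> 4 * \<alpha>"
      using R'S1 S1S norm_triangle_ineq[of "R1 - R'" "R' - S1"]
        norm_triangle_ineq[of "R1 - S1" "S1 - S"] \<alpha> by (simp add: norm_minus_commute)
    then show "\<exists>R \<in> compact_operators. norm R = 1 \<and> norm (blinfun_apply R f0) = 1 \<and>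
        norm (R - S) \<le> 4 * \<alpha>"
      using R1 by blast
  qed
qed

theorem theorem4p8:
  assumes "locally_compact_space (euclidean :: 'l::t2_space topology)"
    and "complex_dim_at_least 2 TYPE('y::complex_banach)"
    and "complex_dim_at_least 2 TYPE('l C0)"
    and "complex_uniformly_convex TYPE('y)"
  shows "BPBp_RSE (compact_operators :: ('l C0 \<Rightarrow>\<^sub>L 'y) set)"
  unfolding BPBp_RSE_def
proof (intro allI impI)
  fix \<epsilon> :: real assume \<epsilon>: "\<epsilon> > 0"
  note ucx = assms(4)
  \<comment> \<open>Localising costs at most \<open>\<alpha>\<close>, attaining the norm \<open>4 \<alpha>\<close> and the last stretching \<open>2 \<alpha>\<close>.\<close>
  define \<alpha> where "\<alpha> = min \<epsilon> 1 / 9"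
  have \<alpha>: "0 < \<alpha>" "\<alpha> \<le> 1" "9 * \<alpha> \<le> \<epsilon>" using \<epsilon> by (simp_all add: \<alpha>_def)
  obtain \<gamma> where \<gamma>: "0 < \<gamma>" "\<gamma> \<le> \<alpha>" "\<gamma> < 1"
    and attain: "\<And>(S :: 'l C0 \<Rightarrow>\<^sub>L 'y) f0.
      \<lbrakk>S \<in> compact_operators; norm S \<le> 1; norm f0 = 1; 1 - \<gamma> \<le> norm (blinfun_apply S f0);
        \<And>h. blinfun_apply S (blinfun_apply (mult_C0 (\<lambda>x. (cmod (apply_C0 f0 x))\<^sup>2)) h)
          = blinfun_apply S h\<rbrakk> \<Longrightarrow>
      \<exists>R \<in> compact_operators. norm R = 1 \<and> norm (blinfun_apply R f0) = 1 \<and> norm (R - S) \<le> 4 * \<alpha>"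
    using attain_at_peak[OF ucx \<alpha>(1,2)] by blast
  obtain \<eta> where \<eta>: "\<eta> > 0"
    and localise: "\<And>(T :: 'l C0 \<Rightarrow>\<^sub>L 'y) f.
      \<lbrakk>T \<in> compact_operators; norm T \<le> 1; norm f = 1; 1 - \<eta> < norm (blinfun_apply T f)\<rbrakk> \<Longrightarrow>
      \<exists>S f0. S \<in> compact_operators \<and> norm S \<le> 1 \<and> norm (S - T) \<le> \<gamma> \<and>
        norm f0 = 1 \<and> norm (f - f0) \<le> \<gamma> \<and> 1 - \<gamma> \<le> norm (blinfun_apply S f0) \<and>
        (\<forall>h. blinfun_apply S (blinfun_apply (mult_C0 (\<lambda>x. (cmod (apply_C0 f0 x))\<^sup>2)) h)
          = blinfun_apply S h)"
    using localise_at_peak[OF ucx \<gamma>(1,3)] by blast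
  show "\<exists>\<eta>. 0 < \<eta> \<and> \<eta> < \<epsilon> \<and>
      (\<forall>T\<in>compact_operators :: ('l C0 \<Rightarrow>\<^sub>L 'y) set.
        \<forall>x. norm T = 1 \<and> norm x = 1 \<and> norm (blinfun_apply T x) > 1 - \<eta> \<longrightarrow>
        (\<exists>S \<in> range_strongly_exposing \<inter> compact_operators. \<exists>x0. norm x0 = 1 \<and>
          norm S = 1 \<and> norm (blinfun_apply S x0) = 1 \<and>
          norm (S - T) < \<epsilon> \<and> norm (x - x0) < \<epsilon>))"
  proof (intro exI[of _ "min \<eta> (\<epsilon> / 2)"] conjI ballI allI impI; (elim conjE)?)
    show "0 < min \<eta> (\<epsilon> / 2)" "min \<eta> (\<epsilon> / 2) < \<epsilon>" using \<eta> \<epsilon> by auto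
    fix T :: "'l C0 \<Rightarrow>\<^sub>L 'y" and f
    assume T: "T \<in> compact_operators" "norm T = 1" and f: "norm f = 1"
      and Tf: "1 - min \<eta> (\<epsilon> / 2) < norm (blinfun_apply T f)"
    obtain S f0 where S: "S \<in> compact_operators" "norm S \<le> 1" "norm (S - T) \<le> \<gamma>"
      and f0: "norm f0 = 1" "norm (f - f0) \<le> \<gamma>" "1 - \<gamma> \<le> norm (blinfun_apply S f0)"
      and live: "\<And>h. blinfun_apply S (blinfun_apply (mult_C0 (\<lambda>x. (cmod (apply_C0 f0 x))\<^sup>2)) h)
          = blinfun_apply S h"
      using localise[OF T(1) _ f] T(2) Tf by fastforce
    obtain R where R: "R \<in> compact_operators" "norm R = 1" "norm (blinfun_apply R f0) = 1"
      "norm (R - S) \<le> 4 * \<alpha>"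
      using attain[OF S(1,2) f0(1,3) live] by blast
    obtain \<psi> where \<psi>: "norming_functional \<psi> (blinfun_apply R f0)"
      using norming_functional_exists by blast
    define Q where "Q = (1 / (1 + \<alpha>)) *\<^sub>R (stretch \<alpha> \<psi> (blinfun_apply R f0) o\<^sub>L R)"
    have Q: "Q \<in> range_strongly_exposing" "norm Q = 1" "norm (blinfun_apply Q f0) = 1"
      "norm (Q - R) \<le> 2 * \<alpha>"
      unfolding Q_def
      using stretch_range_strongly_exposing[OF ucx compact_operators_complex[OF R(1)] R(2) f0(1) R(3) \<psi> \<alpha>(1)]
      by auto
    moreover have "Q \<in> compact_operators"
      unfolding Q_def using \<alpha>
      by (intro compact_operators_scaleR compact_operators_compose_left stretch_complex[OF \<psi> R(3)] R(1)) auto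
    moreover have "norm (Q - T) < \<epsilon>"
      using norm_triangle_ineq[of "Q - R" "R - S"] norm_triangle_ineq[of "Q - S" "S - T"]
        Q(4) R(4) S(3) \<gamma> \<alpha> by simp
    moreover have "norm (f - f0) < \<epsilon>" using f0(2) \<gamma> \<alpha> by linarith
    ultimately show "\<exists>S \<in> range_strongly_exposing \<inter> compact_operators. \<exists>x0. norm x0 = 1 \<and>
        norm S = 1 \<and> norm (blinfun_apply S x0) = 1 \<and>
        norm (S - T) < \<epsilon> \<and> norm (f - x0) < \<epsilon>"
      using f0(1) by blast
  qed
qed

end
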